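(* Let $G=(V,E)$ be a connected finite graph (loops and multiple edges allowed), let $n(G)=|E|-|V|+1$ be its nullity, and let $\mathcal{C}(G)$ be the set of edge subsets $s\subset E$ such that the spanning subgraph $(V,s)$ is a coregraph, i.e. has no vertex of degree one. Then $$2^{n(G)}\le |\mathcal{C}(G)|\le\left(\frac{5-\sqrt5}{2}\right)^{n(G)-1}+\left(\frac{5+\sqrt5}{2}\right)^{n(G)-1}.$$ The lower bound is attained if and only if $\mathrm{core}(G)$ is a subdivision of a bouquet graph. The upper bound is attained if and only if $\mathrm{core}(G)$ is a subdivision of a 3-regular graph or $G$ is a tree.
   Context: Graphs are finite undirected multigraphs; loops and multiple edges are allowed. The degree of a vertex is the number of edge-ends at it (a loop counts twice). A coregraph is a graph in which no vertex has degree exactly one; elements of $\mathcal{C}(G)$ are called sub-coregraphs of $G$. The core $\mathrm{core}(G)$ of $G$ is the graph obtained by clipping vertices of degree one (together with the incident edge) step by step until no vertex of degree one remains; e.g. the core of a tree is a single vertex without edges. The bouquet graph $B_n$ ($n\ge0$) is the graph with a single vertex and $n$ loops. A subdivision of a graph is a graph obtained by adding (zero or more) vertices of degree 2 on its edges. A 3-regular graph is a graph (possibly with loops and multiple edges) in which every vertex has degree 3.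
   Formalization: The last equivalence fails for n(G)=1 (one vertex with one loop attains the upper bound 2, but is neither a tree nor a subdivision of a 3-regular graph), so the case n(G)=1 is added to the graphs attaining the upper bound. *)

theory Defs
  imports Complex_Main "HOL-Library.Multiset"
begin

text \<open>
  Undirected multigraphs: the ends of an edge form a two-element multiset of vertices,
  \<open>{#v, v#}\<close> for a loop. The values of \<open>ends\<close> outside \<open>edges\<close> are irrelevant.
\<close>

record ('v, 'e) mgraph =
  verts :: "'v set"
  edges :: "'e set"
  ends :: "'e \<Rightarrow> 'v multiset"

definition finite_mgraph :: "('v, 'e) mgraph \<Rightarrow> bool" where
  "finite_mgraph G \<longleftrightarrow> finite (verts G) \<and> finite (edges G) \<and>
     (\<forall>e\<in>edges G. size (ends G e) = 2 \<and> set_mset (ends G e) \<subseteq> verts G)"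

definition mgraph_iso :: "('v, 'e) mgraph \<Rightarrow> ('w, 'f) mgraph \<Rightarrow> bool" where
  "mgraph_iso G H \<longleftrightarrow> (\<exists>f g. bij_betw f (verts G) (verts H) \<and> bij_betw g (edges G) (edges H) \<and>
     (\<forall>e\<in>edges G. ends H (g e) = image_mset f (ends G e)))"

text \<open>The multiplicity in \<open>ends\<close> makes a loop count twice.\<close>

definition deg :: "('v, 'e) mgraph \<Rightarrow> 'v \<Rightarrow> nat" where
  "deg G v = (\<Sum>e\<in>edges G. count (ends G e) v)"

definition adjacency :: "('v, 'e) mgraph \<Rightarrow> ('v \<times> 'v) set" where
  "adjacency G = {(u, v). \<exists>e\<in>edges G. ends G e = {#u, v#}}"

definition connected_mgraph :: "('v, 'e) mgraph \<Rightarrow> bool" where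
  "connected_mgraph G \<longleftrightarrow> verts G \<noteq> {} \<and>
     (\<forall>u\<in>verts G. \<forall>v\<in>verts G. (u, v) \<in> (adjacency G)\<^sup>*)"

text \<open>Cycles of length 1 (a loop) and 2 (two parallel edges) are included.\<close>

definition is_cycle :: "('v, 'e) mgraph \<Rightarrow> 'v list \<Rightarrow> 'e list \<Rightarrow> bool" where
  "is_cycle G vs es \<longleftrightarrow> es \<noteq> [] \<and> length vs = length es \<and> distinct vs \<and> distinct es \<and>
     set vs \<subseteq> verts G \<and> set es \<subseteq> edges G \<and>
     (\<forall>i<length es. ends G (es ! i) = {#vs ! i, vs ! (Suc i mod length es)#})"

definition is_tree :: "('v, 'e) mgraph \<Rightarrow> bool" where
  "is_tree G \<longleftrightarrow> connected_mgraph G \<and> (\<nexists>vs es. is_cycle G vs es)"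

definition nullity :: "('v, 'e) mgraph \<Rightarrow> int" where
  "nullity G = int (card (edges G)) - int (card (verts G)) + 1"

definition is_coregraph :: "('v, 'e) mgraph \<Rightarrow> bool" where
  "is_coregraph G \<longleftrightarrow> (\<forall>v\<in>verts G. deg G v \<noteq> 1)"

definition sub_coregraphs :: "('v, 'e) mgraph \<Rightarrow> 'e set set" where
  "sub_coregraphs G = {s. s \<subseteq> edges G \<and> is_coregraph (G\<lparr>edges := s\<rparr>)}"

inductive clip :: "('v, 'e) mgraph \<Rightarrow> ('v, 'e) mgraph \<Rightarrow> bool" for G where
  "v \<in> verts G \<Longrightarrow> deg G v = 1 \<Longrightarrow> e \<in> edges G \<Longrightarrow> v \<in># ends G e \<Longrightarrow>
     clip G (G\<lparr>verts := verts G - {v}, edges := edges G - {e}\<rparr>)"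

text \<open>
  Different clipping orders may end in different, though isomorphic, graphs (clipping a tree can
  end in any of its vertices); the choice operator fixes an arbitrary outcome. The lemma
  \<open>clip_core\<close> below shows that for finite graphs an outcome exists.
\<close>

definition core :: "('v, 'e) mgraph \<Rightarrow> ('v, 'e) mgraph" where
  "core G = (SOME H. clip\<^sup>*\<^sup>* G H \<and> is_coregraph H)"

text \<open>
  Placing one new vertex \<open>w\<close> on an edge \<open>e\<close> with ends \<open>u\<close> and \<open>v\<close> (equal for a loop).
  One of the two new edges may reuse the name \<open>e\<close>.
\<close>

inductive subdivide :: "('v, 'e) mgraph \<Rightarrow> ('v, 'e) mgraph \<Rightarrow> bool" for G where
  "e \<in> edges G \<Longrightarrow> ends G e = {#u, v#} \<Longrightarrow> w \<notin> verts G \<Longrightarrow>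
   e1 \<notin> edges G - {e} \<Longrightarrow> e2 \<notin> edges G - {e} \<Longrightarrow> e1 \<noteq> e2 \<Longrightarrow>
     subdivide G (G\<lparr>verts := insert w (verts G),
                    edges := insert e1 (insert e2 (edges G - {e})),
                    ends := (ends G)(e1 := {#u, w#}, e2 := {#w, v#})\<rparr>)"

definition is_subdivision_of :: "('v, 'e) mgraph \<Rightarrow> ('w, 'f) mgraph \<Rightarrow> bool" where
  "is_subdivision_of G R \<longleftrightarrow> (\<exists>R'. subdivide\<^sup>*\<^sup>* R R' \<and> mgraph_iso R' G)"

definition bouquet :: "nat \<Rightarrow> (nat, nat) mgraph" where
  "bouquet n = \<lparr>verts = {0}, edges = {..<n}, ends = (\<lambda>_. {#0, 0#})\<rparr>"

text \<open>
  Natural numbers as vertices and edges represent every finite graph up to isomorphism, and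
  \<open>is_subdivision_of\<close> is closed under isomorphism in its first argument. A cycle is not a
  subdivision of a 3-regular graph, since it has no vertex of degree 3; this is why graphs of
  nullity 1, for which the upper bound on the number of sub-coregraphs is attained as well, have to
  be listed separately among the extremal graphs.
\<close>

definition is_subdivision_of_regular :: "('v, 'e) mgraph \<Rightarrow> nat \<Rightarrow> bool" where
  "is_subdivision_of_regular G d \<longleftrightarrow> (\<exists>R :: (nat, nat) mgraph.
     finite_mgraph R \<and> (\<forall>v\<in>verts R. deg R v = d) \<and> is_subdivision_of G R)"

lemma finite_mgraph_clip: "clip G H \<Longrightarrow> finite_mgraph G \<Longrightarrow> finite_mgraph H"
proof (induction rule: clip.cases)
  case (1 v e)
  have "v \<notin># ends G f" if f: "f \<in> edges G" "f \<noteq> e" for f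
  proof
    assume vf: "v \<in># ends G f"
    have fin: "finite (edges G)"
      using 1 by (simp add: finite_mgraph_def)
    have "(\<Sum>e\<in>{e, f}. count (ends G e) v) \<le> deg G v"
      unfolding deg_def by (rule sum_mono2) (use fin f 1 in auto)
    moreover have "count (ends G e) v \<ge> 1" "count (ends G f) v \<ge> 1"
      using 1 vf by simp_all
    ultimately show False
      using f 1 by simp
  qed
  then show ?case
    using 1 by (auto simp: finite_mgraph_def)
qed

lemma clip_core:
  assumes "finite_mgraph G"
  shows "clip\<^sup>*\<^sup>* G (core G)" and "is_coregraph (core G)"
proof -
  have "\<exists>H. clip\<^sup>*\<^sup>* G H \<and> is_coregraph H"
    using assms
  proof (induction "card (verts G)" arbitrary: G rule: less_induct)
    case less
    show ?case
    proof (cases "is_coregraph G")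
      case False
      then obtain v where v: "v \<in> verts G" "deg G v = 1"
        by (auto simp: is_coregraph_def)
      then obtain e where e: "e \<in> edges G" "v \<in># ends G e"
        unfolding deg_def by (metis count_eq_zero_iff sum.neutral zero_neq_one)
      define H where "H = G\<lparr>verts := verts G - {v}, edges := edges G - {e}\<rparr>"
      have step: "clip G H"
        unfolding H_def using v e by (intro clip.intros)
      have "card (verts H) < card (verts G)"
        using card_Diff1_less[of "verts G" v] v less.prems
        unfolding H_def finite_mgraph_def by (simp del: card_Diff_insert card_Diff_singleton)
      with less finite_mgraph_clip[OF step] step show ?thesis
        by (meson converse_rtranclp_into_rtranclp)
    qed blast
  qed
  from someI_ex[OF this] show "clip\<^sup>*\<^sup>* G (core G)" "is_coregraph (core G)"
    unfolding core_def by auto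
qed

end

theory Submission
  imports Defs
begin

text \<open>
  Give each vertex of degree \<open>d\<close> in an edge subset the weight \<open>f d\<close>, and let the weighted
  count of \<open>G\<close> be the sum over all edge subsets of the product of the vertex weights. For the
  indicator of \<open>d \<noteq> 1\<close> this is the number of sub-coregraphs. The theorem comes from comparing this
  indicator with weights whose weighted count depends on the nullity alone.

  Such weights are those with \<open>f m * f n + f (m + 1) * f (n + 1) = f (m + n)\<close>: contracting a
  non-loop edge merges two vertices, the two terms on the left belong to the subsets without and
  with that edge, and so the weighted count does not change (\<open>weighted_count_contract\<close>). Whenever
  \<open>a * b = -1\<close>, the function \<open>conj_weight a b\<close> is such a weight; it has the values \<open>1\<close> at \<open>0\<close> and \<open>0\<close>
  at \<open>1\<close>. Contracting down to one vertex, where the sum over the subsets of the loops is binomial,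
  gives \<open>(1 + a\<^sup>2) powi (n - 1) + (1 + b\<^sup>2) powi (n - 1)\<close> for the nullity \<open>n\<close>
  (\<open>weighted_count_conj_weight\<close>). Two choices of \<open>a\<close> and \<open>b\<close> yield the two bounds.

  \<^item> For \<open>1\<close> and \<open>-1\<close> the weight is the indicator of even degree. Even subgraphs are sub-coregraphs,
    which gives the lower bound \<open>2 powi n\<close>; equality means that every sub-coregraph is even.

  \<^item> For the golden ratio and its conjugate the weights are the Fibonacci numbers
    \<open>1, 0, 1, 1, 2, 3, \<dots>\<close>. They are at least \<open>1\<close> except at degree \<open>1\<close>, which gives the upper
    bound. They equal \<open>1\<close> exactly at the degrees \<open>0\<close>, \<open>2\<close> and \<open>3\<close>, so equality for a coregraph means
    that no degree exceeds \<open>3\<close>.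

  Clipping changes neither the set of sub-coregraphs nor the nullity, and subdivision changes
  neither the number of sub-coregraphs nor the nullity. Hence the equality cases may be studied on
  the core, and there on a graph without suppressible vertices of degree \<open>2\<close>, which exists by
  \<open>exists_unsubdivided\<close>. If every sub-coregraph is even and such a graph had two vertices, all degrees
  would be at least \<open>4\<close>, and deleting a non-loop edge would leave a sub-coregraph with a vertex of
  odd degree; so it is a bouquet. If the degrees are at most \<open>3\<close> and some degree is \<open>3\<close>, such a graph
  is 3-regular; otherwise the core is a single vertex or a cycle, and the nullity is \<open>0\<close> or \<open>1\<close>.
  The nullity is \<open>0\<close> exactly for trees, since both bounds are then \<open>1\<close> and the edge set of a cycle
  would be a second sub-coregraph besides the empty one.
\<close>

section \<open>Connectivity and degrees\<close>

lemma deg_edges_update: "deg (G\<lparr>edges := s\<rparr>) v = (\<Sum>e\<in>s. count (ends G e) v)"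
  by (simp add: deg_def)

lemma ends_pair:
  assumes "finite_mgraph G" "e \<in> edges G"
  obtains u v where "ends G e = {#u, v#}" "u \<in> verts G" "v \<in> verts G"
proof -
  have "size (ends G e) = Suc (Suc 0)" and sub: "set_mset (ends G e) \<subseteq> verts G"
    using assms by (auto simp: finite_mgraph_def)
  then obtain u M where 1: "ends G e = add_mset u M" "size M = Suc 0"
    by (metis size_eq_Suc_imp_eq_union size_add_mset nat.inject add_mset_add_single)
  then obtain v where "M = {#v#}"
    by (metis One_nat_def size_1_singleton_mset)
  with 1 sub that show ?thesis by auto
qed

lemma ends_pair_at:
  assumes "finite_mgraph G" "e \<in> edges G" "u \<in># ends G e"
  obtains v where "ends G e = {#u, v#}" "u \<in> verts G" "v \<in> verts G"
proof -
  obtain x y where "ends G e = {#x, y#}" "x \<in> verts G" "y \<in> verts G"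
    using ends_pair[OF assms(1,2)] .
  with assms(3) that show ?thesis by (auto simp: add_mset_commute)
qed

text \<open>
  Contraction, clipping and suppression of a vertex all send one vertex to a neighbour and fix the
  others; walks are carried along by this map.
\<close>

lemma connected_retract:
  assumes "connected_mgraph G" "verts G' \<noteq> {}" "verts G' \<subseteq> verts G"
    and fixed: "\<And>x. x \<in> verts G' \<Longrightarrow> h x = x"
    and step: "\<And>e x y. e \<in> edges G \<Longrightarrow> ends G e = {#x, y#} \<Longrightarrow> (h x, h y) \<in> (adjacency G')\<^sup>*"
  shows "connected_mgraph G'"
  unfolding connected_mgraph_def
proof (intro conjI ballI)
  fix x y assume xy: "x \<in> verts G'" "y \<in> verts G'"
  have "(x, y) \<in> (adjacency G)\<^sup>*"
    using assms(1,3) xy by (auto simp: connected_mgraph_def)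
  then have "(h x, h y) \<in> (adjacency G')\<^sup>*"
    by (induction rule: rtrancl_induct) (use step in \<open>auto simp: adjacency_def intro: rtrancl_trans\<close>)
  then show "(x, y) \<in> (adjacency G')\<^sup>*"
    using fixed xy by simp
qed fact

text \<open>
  The first step of a walk from \<open>v\<close> to \<open>x\<close> that leaves \<open>v\<close>. It supplies both a non-loop edge and
  the fact that no vertex is isolated when there is another one.
\<close>

lemma connected_leaving_edge:
  assumes "connected_mgraph G" "v \<in> verts G" "x \<in> verts G" "v \<noteq> x"
  obtains e y where "e \<in> edges G" "ends G e = {#v, y#}" "y \<noteq> v"
proof -
  have "(v, x) \<in> (adjacency G)\<^sup>*"
    using assms by (auto simp: connected_mgraph_def)
  then have "x = v \<or> (\<exists>e\<in>edges G. \<exists>y. ends G e = {#v, y#} \<and> y \<noteq> v)"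
    by (induction rule: rtrancl_induct) (auto simp: adjacency_def)
  then show ?thesis using that assms(4) by blast
qed

lemma deg_eq_0_iff:
  assumes "finite_mgraph G"
  shows "deg G v = 0 \<longleftrightarrow> (\<forall>e\<in>edges G. v \<notin># ends G e)"
  using assms by (auto simp: deg_def finite_mgraph_def not_in_iff)

section \<open>Vertex weights invariant under contraction\<close>

text \<open>
  The solution of the recurrence \<open>f (n + 2) = (a + b) * f (n + 1) + f n\<close> with \<open>f 0 = 1\<close> and
  \<open>f 1 = 0\<close>, in Binet form; \<open>a\<close> and \<open>b\<close> with \<open>a * b = -1\<close> are the roots of its characteristic
  polynomial.
\<close>

definition conj_weight :: "real \<Rightarrow> real \<Rightarrow> nat \<Rightarrow> real" where
  "conj_weight a b n = a ^ n / (1 + a\<^sup>2) + b ^ n / (1 + b\<^sup>2)"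

lemma one_plus_square_pos: "1 + (x::real)\<^sup>2 > 0"
  by (simp add: add_pos_nonneg)

lemma conj_weight_0:
  assumes "a * b = -1"
  shows "conj_weight a b 0 = 1"
proof -
  have "(1 + a\<^sup>2) * (1 + b\<^sup>2) = (1 + b\<^sup>2) + (1 + a\<^sup>2)"
    using assms by (simp add: algebra_simps flip: power_mult_distrib)
  then show ?thesis
    using one_plus_square_pos[of a] one_plus_square_pos[of b]
    by (simp add: conj_weight_def field_simps)
qed

lemma conj_weight_1:
  assumes "a * b = -1"
  shows "conj_weight a b (Suc 0) = 0"
proof -
  have "a * (1 + b\<^sup>2) + b * (1 + a\<^sup>2) = (a + b) * (1 + a * b)"
    by (simp add: algebra_simps power2_eq_square)
  then show ?thesis
    using one_plus_square_pos[of a] one_plus_square_pos[of b] assms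
    by (simp add: conj_weight_def add_frac_eq)
qed

lemma conj_weight_rec:
  assumes "a * b = -1"
  shows "conj_weight a b (Suc (Suc n)) = (a + b) * conj_weight a b (Suc n) + conj_weight a b n"
proof -
  have *: "x ^ Suc (Suc n) / c = (a + b) * (x ^ Suc n / c) + x ^ n / c" if "x = a \<or> x = b" for x c
  proof -
    have "x\<^sup>2 = (a + b) * x + 1"
      using that assms by (auto simp: algebra_simps power2_eq_square)
    then have "x ^ n * x\<^sup>2 = x ^ n * ((a + b) * x + 1)" by simp
    then have "x ^ Suc (Suc n) = (a + b) * x ^ Suc n + x ^ n"
      by (simp add: algebra_simps power2_eq_square)
    then show ?thesis by (simp only: add_divide_distrib times_divide_eq_right)
  qed
  show ?thesis
    unfolding conj_weight_def *[OF disjI1[OF refl]] *[OF disjI2[OF refl]]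
    by (simp only: distrib_left ac_simps)
qed

text \<open>
  The mixed terms carry the factor \<open>1 + a * b = 0\<close>, and the pure terms carry factors \<open>1 + a\<^sup>2\<close> and
  \<open>1 + b\<^sup>2\<close>, which cancel one denominator each.
\<close>

lemma conj_weight_contract:
  assumes "a * b = -1"
  shows "conj_weight a b m * conj_weight a b n + conj_weight a b (Suc m) * conj_weight a b (Suc n) =
    conj_weight a b (m + n)"
proof -
  define A B where "A = 1 + a\<^sup>2" and "B = 1 + b\<^sup>2"
  have pos: "A \<noteq> 0" "B \<noteq> 0"
    using one_plus_square_pos[of a] one_plus_square_pos[of b] by (auto simp: A_def B_def)
  have W: "conj_weight a b k = a ^ k / A + b ^ k / B" for k
    by (simp add: conj_weight_def A_def B_def)
  have "conj_weight a b m * conj_weight a b n + conj_weight a b (Suc m) * conj_weight a b (Suc n)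
    = (a ^ m / A) * (a ^ n / A) * (1 + a\<^sup>2) + (b ^ m / B) * (b ^ n / B) * (1 + b\<^sup>2)
      + ((a ^ m / A) * (b ^ n / B) + (b ^ m / B) * (a ^ n / A)) * (1 + a * b)"
    unfolding W by (simp add: algebra_simps add_divide_distrib power2_eq_square)
  also have "\<dots> = conj_weight a b (m + n)"
    unfolding assms W A_def[symmetric] B_def[symmetric]
    using pos by (simp add: power_add)
  finally show ?thesis .
qed

definition weighted_count :: "(nat \<Rightarrow> real) \<Rightarrow> ('v, 'e) mgraph \<Rightarrow> real" where
  "weighted_count f G = (\<Sum>s\<in>Pow (edges G). \<Prod>v\<in>verts G. f (deg (G\<lparr>edges := s\<rparr>) v))"

text \<open>
  Contraction of the edge \<open>e\<close> with ends \<open>u\<close> and \<open>w\<close>; the merged vertex keeps the name \<open>u\<close>.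
\<close>

definition contract :: "('v, 'e) mgraph \<Rightarrow> 'e \<Rightarrow> 'v \<Rightarrow> 'v \<Rightarrow> ('v, 'e) mgraph" where
  "contract G e u w = \<lparr>verts = verts G - {w}, edges = edges G - {e},
     ends = (\<lambda>d. image_mset (id(w := u)) (ends G d))\<rparr>"

lemma count_image_mset_merge:
  assumes "u \<noteq> w"
  shows "count (image_mset (id(w := u)) M) x =
    (if x = w then 0 else if x = u then count M u + count M w else count M x)"
  using assms by (induction M) auto

text \<open>
  Subsets \<open>s\<close> and \<open>insert e s\<close> of \<open>G\<close> are paired and matched with the subset \<open>s\<close> of the contracted
  graph: if \<open>s\<close> has degrees \<open>m\<close> and \<open>n\<close> at \<open>u\<close> and \<open>w\<close>, then it has degree \<open>m + n\<close> at the merged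
  vertex, and all other degrees agree.
\<close>

lemma weighted_count_contract:
  assumes fin: "finite_mgraph G" and e: "e \<in> edges G" "ends G e = {#u, w#}" "u \<noteq> w"
    and f: "\<And>m n. f m * f n + f (Suc m) * f (Suc n) = f (m + n)"
  shows "weighted_count f (contract G e u w) = weighted_count f G"
proof -
  let ?V = "verts G" and ?E = "edges G" and ?D = "\<lambda>s. deg (G\<lparr>edges := s\<rparr>)"
  have finV: "finite ?V" and finE: "finite ?E" and uw: "u \<in> ?V" "w \<in> ?V"
    using fin e by (auto simp: finite_mgraph_def)
  define V' where "V' = ?V - {u, w}"
  have V: "?V = insert u (insert w V')" "u \<notin> insert w V'" "w \<notin> V'" "finite V'"
    and V2: "?V - {w} = insert u V'" "u \<notin> V'"
    using uw e(3) finV by (auto simp: V'_def)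
  have key: "(\<Prod>v\<in>?V. f (?D s v)) + (\<Prod>v\<in>?V. f (?D (insert e s) v)) =
      (\<Prod>v\<in>?V - {w}. f (deg (contract G e u w\<lparr>edges := s\<rparr>) v))" if s: "s \<in> Pow (?E - {e})" for s
  proof -
    have es: "e \<notin> s" "finite s" using s finE by (auto intro: finite_subset)
    have D: "?D (insert e s) v = count {#u, w#} v + ?D s v" for v
      using es e by (simp add: deg_edges_update)
    have C: "deg (contract G e u w\<lparr>edges := s\<rparr>) v = (if v = u then ?D s u + ?D s w else ?D s v)"
      if "v \<noteq> w" for v
      using that e by (simp add: deg_edges_update contract_def deg_def count_image_mset_merge sum.distrib
          flip: id_def)
    have "(\<Prod>v\<in>V'. f (?D (insert e s) v)) = (\<Prod>v\<in>V'. f (?D s v))"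
      by (intro prod.cong refl) (auto simp: D V'_def)
    moreover have "(\<Prod>v\<in>V'. f (deg (contract G e u w\<lparr>edges := s\<rparr>) v)) = (\<Prod>v\<in>V'. f (?D s v))"
      by (intro prod.cong refl) (auto simp: C V'_def)
    ultimately show ?thesis
      unfolding V2 V(1) using V V2 e(3)
      by (simp add: C[of u] D[of u] D[of w] algebra_simps flip: f)
  qed
  have "weighted_count f G = (\<Sum>s\<in>Pow (insert e (?E - {e})). \<Prod>v\<in>?V. f (?D s v))"
    using e by (simp add: weighted_count_def insert_absorb)
  also have "\<dots> = (\<Sum>s\<in>Pow (?E - {e}). \<Prod>v\<in>?V. f (?D s v)) +
      (\<Sum>s\<in>insert e ` Pow (?E - {e}). \<Prod>v\<in>?V. f (?D s v))"
    unfolding Pow_insert by (rule sum.union_disjoint) (use finE in auto)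
  also have "(\<Sum>s\<in>insert e ` Pow (?E - {e}). \<Prod>v\<in>?V. f (?D s v)) =
      (\<Sum>s\<in>Pow (?E - {e}). \<Prod>v\<in>?V. f (?D (insert e s) v))"
    by (subst sum.reindex) (auto simp: inj_on_def)
  also have "(\<Sum>s\<in>Pow (?E - {e}). \<Prod>v\<in>?V. f (?D s v)) + \<dots> = weighted_count f (contract G e u w)"
    using key by (simp add: weighted_count_def contract_def flip: sum.distrib)
  finally show ?thesis by simp
qed

lemma contract_props:
  assumes fin: "finite_mgraph G" and con: "connected_mgraph G"
    and e: "e \<in> edges G" "ends G e = {#u, w#}" "u \<noteq> w"
  shows "finite_mgraph (contract G e u w)" "connected_mgraph (contract G e u w)"
    "nullity (contract G e u w) = nullity G" "card (verts (contract G e u w)) < card (verts G)"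
proof -
  have uw: "u \<in> verts G" "w \<in> verts G" and finV: "finite (verts G)" and finE: "finite (edges G)"
    using fin e by (auto simp: finite_mgraph_def)
  show "finite_mgraph (contract G e u w)"
    using fin e uw by (auto simp: finite_mgraph_def contract_def)
  show "connected_mgraph (contract G e u w)"
  proof (rule connected_retract[OF con, where h = "id(w := u)"])
    fix d x y assume d: "d \<in> edges G" "ends G d = {#x, y#}"
    show "((id(w := u)) x, (id(w := u)) y) \<in> (adjacency (contract G e u w))\<^sup>*"
    proof (cases "d = e")
      case True
      then show ?thesis using d e by (auto simp: add_eq_conv_ex)
    next
      case False
      with d have "((id(w := u)) x, (id(w := u)) y) \<in> adjacency (contract G e u w)"
        by (auto simp: adjacency_def contract_def intro!: bexI[of _ d])
      then show ?thesis by blast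
    qed
  qed (use uw e in \<open>auto simp: contract_def\<close>)
  have "card (verts G) > 0" "card (edges G) > 0"
    using uw e finV finE by (auto simp: card_gt_0_iff)
  then show "nullity (contract G e u w) = nullity G" "card (verts (contract G e u w)) < card (verts G)"
    using uw e finV finE by (auto simp: nullity_def contract_def card_Diff_singleton)
qed

lemma weighted_count_single_vertex:
  assumes fin: "finite_mgraph G" and V: "verts G = {v}"
  shows "weighted_count f G = (\<Sum>s\<in>Pow (edges G). f (2 * card s))"
proof -
  have "ends G e = {#v, v#}" if e: "e \<in> edges G" for e
    by (rule ends_pair[OF fin e]) (use V in auto)
  then have "deg (G\<lparr>edges := s\<rparr>) v = 2 * card s" if "s \<subseteq> edges G" for s
    using that by (simp add: deg_edges_update subset_iff)
  then show ?thesis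
    using V by (simp add: weighted_count_def)
qed

lemma sum_Pow_power_card:
  fixes y :: real
  assumes "finite E"
  shows "(\<Sum>s\<in>Pow E. y ^ card s) = (1 + y) ^ card E"
  using prod_add[OF assms, of "\<lambda>_. y" "\<lambda>_. 1"] by (simp add: add.commute)

text \<open>
  Contract non-loop edges until one vertex remains. All edges are then loops, their number is the
  nullity, and \<open>k\<close> chosen loops contribute \<open>a ^ (2 * k)\<close> and \<open>b ^ (2 * k)\<close>, so that the binomial
  theorem applies.
\<close>

lemma weighted_count_conj_weight:
  assumes fin: "finite_mgraph G" and con: "connected_mgraph G" and ab: "a * b = -1"
  shows "weighted_count (conj_weight a b) G =
    (1 + a\<^sup>2) powi (nullity G - 1) + (1 + b\<^sup>2) powi (nullity G - 1)"
  using fin con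
proof (induction "card (verts G)" arbitrary: G rule: less_induct)
  case less
  show ?case
  proof (cases "\<exists>x\<in>verts G. \<exists>y\<in>verts G. x \<noteq> y")
    case True
    then obtain e u w where e: "e \<in> edges G" "ends G e = {#u, w#}" "u \<noteq> w"
      using connected_leaving_edge[OF less.prems(2)] by metis
    note C = contract_props[OF less.prems e]
    have "weighted_count (conj_weight a b) G = weighted_count (conj_weight a b) (contract G e u w)"
      using weighted_count_contract[OF less.prems(1) e conj_weight_contract[OF ab]] by simp
    then show ?thesis
      using less.hyps[OF C(4,1,2)] C(3) by simp
  next
    case False
    then obtain v where V: "verts G = {v}"
      using less.prems(2) by (auto simp: connected_mgraph_def)
    have finE: "finite (edges G)" using less.prems(1) by (simp add: finite_mgraph_def)
    have *: "(\<Sum>s\<in>Pow (edges G). x ^ (2 * card s) / (1 + x\<^sup>2)) = (1 + x\<^sup>2) powi (nullity G - 1)"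
      for x :: real
      using one_plus_square_pos[of x] V
      by (simp add: power_mult sum_Pow_power_card[OF finE] nullity_def power_int_diff
          flip: sum_divide_distrib)
    show ?thesis
      by (simp add: weighted_count_single_vertex[OF less.prems(1) V] conj_weight_def sum.distrib *)
  qed
qed

section \<open>The two bounds\<close>

lemma finite_sub_coregraphs: "finite_mgraph G \<Longrightarrow> finite (sub_coregraphs G)"
  by (rule finite_subset[of _ "Pow (edges G)"]) (auto simp: sub_coregraphs_def finite_mgraph_def)

text \<open>
  A subset that is not a sub-coregraph has a vertex of degree 1, whose weight vanishes.
\<close>

lemma weighted_count_sub_coregraphs:
  assumes fin: "finite_mgraph G" and "f 1 = 0"
  shows "weighted_count f G = (\<Sum>s\<in>sub_coregraphs G. \<Prod>v\<in>verts G. f (deg (G\<lparr>edges := s\<rparr>) v))"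
  unfolding weighted_count_def
proof (rule sum.mono_neutral_right)
  show "\<forall>s\<in>Pow (edges G) - sub_coregraphs G. (\<Prod>v\<in>verts G. f (deg (G\<lparr>edges := s\<rparr>) v)) = 0"
    using assms by (force simp: sub_coregraphs_def is_coregraph_def finite_mgraph_def intro!: prod_zero)
qed (use fin in \<open>auto simp: sub_coregraphs_def finite_mgraph_def\<close>)

lemma conj_weight_parity: "conj_weight 1 (-1) n = (if even n then 1 else 0)"
  by (simp add: conj_weight_def)

lemma weighted_count_parity:
  assumes "finite_mgraph G" "connected_mgraph G"
  shows "weighted_count (conj_weight 1 (-1)) G = 2 powi nullity G"
  using weighted_count_conj_weight[OF assms, of 1 "-1"] by (simp add: power_int_diff)

lemma prod_parity:
  assumes "finite V"
  shows "(\<Prod>v\<in>V. conj_weight 1 (-1) (d v)) = (if \<forall>v\<in>V. even (d v) then 1 else 0)"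
  using assms by (induction V rule: finite_induct) (auto simp: conj_weight_parity)

lemma card_sub_coregraphs_lower:
  assumes "finite_mgraph G" "connected_mgraph G"
  shows "2 powi nullity G \<le> real (card (sub_coregraphs G))"
proof -
  have "2 powi nullity G = (\<Sum>s\<in>sub_coregraphs G. \<Prod>v\<in>verts G. conj_weight 1 (-1) (deg (G\<lparr>edges := s\<rparr>) v))"
    using weighted_count_parity[OF assms] weighted_count_sub_coregraphs[OF assms(1), of "conj_weight 1 (-1)"]
    by (simp add: conj_weight_parity)
  also have "\<dots> \<le> (\<Sum>s\<in>sub_coregraphs G. 1)"
    by (rule sum_mono) (use assms in \<open>simp add: prod_parity finite_mgraph_def\<close>)
  finally show ?thesis by simp
qed

text \<open>
  In the lower bound every sub-coregraph contributes its parity indicator, which is at most 1; in the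
  case of equality none of them can contribute 0.
\<close>

lemma card_sub_coregraphs_lower_eq:
  assumes "finite_mgraph G" "connected_mgraph G"
    and eq: "real (card (sub_coregraphs G)) = 2 powi nullity G"
    and s: "s \<in> sub_coregraphs G" "v \<in> verts G"
  shows "even (deg (G\<lparr>edges := s\<rparr>) v)"
proof -
  let ?p = "\<lambda>s. \<Prod>v\<in>verts G. conj_weight 1 (-1) (deg (G\<lparr>edges := s\<rparr>) v)"
  have finV: "finite (verts G)" using assms by (simp add: finite_mgraph_def)
  have "(\<Sum>s\<in>sub_coregraphs G. ?p s) = (\<Sum>s\<in>sub_coregraphs G. 1)"
    using weighted_count_parity[OF assms(1,2)] eq
      weighted_count_sub_coregraphs[OF assms(1), of "conj_weight 1 (-1)"]
    by (simp add: conj_weight_parity)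
  then have "?p s = 1"
    by (rule sum_mono_inv[OF _ _ s(1)])
      (use finite_sub_coregraphs[OF assms(1)] finV in \<open>auto simp: prod_parity\<close>)
  then show ?thesis
    using s finV by (auto simp: prod_parity split: if_splits)
qed

text \<open>
  The sum of the two roots is 1, so the recurrence is that of the Fibonacci numbers, shifted to
  start with \<open>1, 0\<close>.
\<close>

abbreviation golden_weight :: "nat \<Rightarrow> real" where
  "golden_weight \<equiv> conj_weight ((1 - sqrt 5) / 2) ((1 + sqrt 5) / 2)"

lemma golden_ab: "(1 - sqrt 5) / 2 * ((1 + sqrt 5) / 2) = -1"
  by (simp add: algebra_simps)

lemma golden_weight_simps [simp]:
  "golden_weight 0 = 1" "golden_weight (Suc 0) = 0"
  "golden_weight (Suc (Suc n)) = golden_weight (Suc n) + golden_weight n"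
  using conj_weight_0[OF golden_ab] conj_weight_1[OF golden_ab] conj_weight_rec[OF golden_ab, of n]
  by (simp_all add: field_simps)

lemma golden_weight_ge_2: "golden_weight (n + 4) \<ge> 2"
  by (induction n rule: induct_nat_012) (simp_all add: eval_nat_numeral)

lemma golden_weight_le_3: "n \<noteq> 1 \<Longrightarrow> n \<le> 3 \<Longrightarrow> golden_weight n = 1"
  by (cases "n = 0"; cases "n = 2"; cases "n = 3") (simp_all add: eval_nat_numeral)

lemma golden_weight_ge_1: "n \<noteq> 1 \<Longrightarrow> golden_weight n \<ge> 1"
  using golden_weight_le_3[of n] golden_weight_ge_2[of "n - 4"] by (cases "n \<le> 3") auto

lemma weighted_count_golden:
  assumes "finite_mgraph G" "connected_mgraph G"
  shows "weighted_count golden_weight G =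
    ((5 - sqrt 5) / 2) powi (nullity G - 1) + ((5 + sqrt 5) / 2) powi (nullity G - 1)"
proof -
  have *: "1 + ((1 - sqrt 5) / 2)\<^sup>2 = (5 - sqrt 5) / 2" "1 + ((1 + sqrt 5) / 2)\<^sup>2 = (5 + sqrt 5) / 2"
    by (simp_all add: power2_eq_square field_simps)
  then show ?thesis
    using weighted_count_conj_weight[OF assms golden_ab] by (simp only: *)
qed

lemma golden_weight_sub_coregraph_ge_1:
  assumes "s \<in> sub_coregraphs G" "v \<in> verts G"
  shows "golden_weight (deg (G\<lparr>edges := s\<rparr>) v) \<ge> 1"
  using assms by (intro golden_weight_ge_1) (auto simp: sub_coregraphs_def is_coregraph_def)

lemma card_sub_coregraphs_upper:
  assumes "finite_mgraph G" "connected_mgraph G"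
  shows "real (card (sub_coregraphs G))
      \<le> ((5 - sqrt 5) / 2) powi (nullity G - 1) + ((5 + sqrt 5) / 2) powi (nullity G - 1)"
proof -
  have "real (card (sub_coregraphs G)) = (\<Sum>s\<in>sub_coregraphs G. 1)" by simp
  also have "\<dots> \<le> (\<Sum>s\<in>sub_coregraphs G. \<Prod>v\<in>verts G. golden_weight (deg (G\<lparr>edges := s\<rparr>) v))"
    by (intro sum_mono prod_ge_1 golden_weight_sub_coregraph_ge_1)
  also have "\<dots> = weighted_count golden_weight G"
    using weighted_count_sub_coregraphs[OF assms(1), of golden_weight] by simp
  finally show ?thesis using weighted_count_golden[OF assms] by simp
qed

text \<open>
  Equality forces the product of the weights to be 1 for every sub-coregraph. The whole edge set is
  one of them and has the largest degrees, so it decides the matter.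
\<close>

lemma card_sub_coregraphs_upper_eq_iff:
  assumes fin: "finite_mgraph G" and con: "connected_mgraph G" and core: "is_coregraph G"
  shows "real (card (sub_coregraphs G))
      = ((5 - sqrt 5) / 2) powi (nullity G - 1) + ((5 + sqrt 5) / 2) powi (nullity G - 1)
    \<longleftrightarrow> (\<forall>v\<in>verts G. deg G v \<le> 3)"
proof -
  let ?p = "\<lambda>s. \<Prod>v\<in>verts G. golden_weight (deg (G\<lparr>edges := s\<rparr>) v)"
  have finV: "finite (verts G)" and finE: "finite (edges G)"
    using fin by (auto simp: finite_mgraph_def)
  have full: "edges G \<in> sub_coregraphs G"
    using core by (simp add: sub_coregraphs_def)
  have ge: "1 \<le> ?p s" if "s \<in> sub_coregraphs G" for s
    by (intro prod_ge_1 golden_weight_sub_coregraph_ge_1 that)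
  have sum: "(\<Sum>s\<in>sub_coregraphs G. ?p s)
      = ((5 - sqrt 5) / 2) powi (nullity G - 1) + ((5 + sqrt 5) / 2) powi (nullity G - 1)"
    using weighted_count_golden[OF fin con] weighted_count_sub_coregraphs[OF fin, of golden_weight]
    by simp
  show ?thesis unfolding sum[symmetric]
  proof
    assume "real (card (sub_coregraphs G)) = (\<Sum>s\<in>sub_coregraphs G. ?p s)"
    then have "(\<Sum>s\<in>sub_coregraphs G. 1) = (\<Sum>s\<in>sub_coregraphs G. ?p s)" by simp
    then have p1: "?p (edges G) = 1"
      using sum_mono_inv[where f = "\<lambda>_. 1" and g = ?p, OF _ ge full finite_sub_coregraphs[OF fin]]
      by simp
    show "\<forall>v\<in>verts G. deg G v \<le> 3"
    proof (rule ccontr)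
      assume "\<not> ?thesis"
      then obtain v where v: "v \<in> verts G" "deg G v \<ge> 4" by force
      have "1 * 2 \<le> (\<Prod>x\<in>verts G - {v}. golden_weight (deg (G\<lparr>edges := edges G\<rparr>) x)) * golden_weight (deg G v)"
      proof (rule mult_mono)
        show "1 \<le> (\<Prod>x\<in>verts G - {v}. golden_weight (deg (G\<lparr>edges := edges G\<rparr>) x))"
          by (intro prod_ge_1 golden_weight_sub_coregraph_ge_1[OF full]) auto
        then show "0 \<le> (\<Prod>x\<in>verts G - {v}. golden_weight (deg (G\<lparr>edges := edges G\<rparr>) x))"
          by linarith
      qed (use golden_weight_ge_2[of "deg G v - 4"] v(2) in auto)
      also have "\<dots> = ?p (edges G)"
        using v finV by (subst (2) prod.remove[of _ v]) auto
      finally show False using p1 by simp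
    qed
  next
    assume le: "\<forall>v\<in>verts G. deg G v \<le> 3"
    have "?p s = 1" if s: "s \<in> sub_coregraphs G" for s
    proof (intro prod.neutral ballI golden_weight_le_3)
      fix v assume v: "v \<in> verts G"
      show "deg (G\<lparr>edges := s\<rparr>) v \<noteq> 1"
        using s v by (auto simp: sub_coregraphs_def is_coregraph_def)
      have "deg (G\<lparr>edges := s\<rparr>) v \<le> deg G v"
        unfolding deg_edges_update unfolding deg_def
        using s finE by (intro sum_mono2) (auto simp: sub_coregraphs_def)
      then show "deg (G\<lparr>edges := s\<rparr>) v \<le> 3"
        using le v by force
    qed
    then show "real (card (sub_coregraphs G)) = (\<Sum>s\<in>sub_coregraphs G. ?p s)" by simp
  qed
qed

section \<open>Clipping and cycles\<close>

text \<open>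
  The edge at a vertex of degree 1 lies in no sub-coregraph, so clipping leaves the set of
  sub-coregraphs unchanged, not only its size.
\<close>

lemma clip_invariants:
  assumes "clip G H" "finite_mgraph G"
  shows "sub_coregraphs H = sub_coregraphs G" "nullity H = nullity G"
    "connected_mgraph G \<Longrightarrow> connected_mgraph H"
    "is_cycle H vs es \<Longrightarrow> is_cycle G vs es"
proof -
  from assms(1) obtain v e where v: "v \<in> verts G" "deg G v = 1" and e: "e \<in> edges G" "v \<in># ends G e"
    and H: "H = G\<lparr>verts := verts G - {v}, edges := edges G - {e}\<rparr>"
    by (auto elim: clip.cases)
  have fin: "finite (verts G)" "finite (edges G)" using assms(2) by (auto simp: finite_mgraph_def)
  obtain a where a: "ends G e = {#v, a#}" "a \<in> verts G"
    using ends_pair_at[OF assms(2) e] by metis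
  have deg_v: "deg G v = count (ends G e) v + (\<Sum>d\<in>edges G - {e}. count (ends G d) v)"
    unfolding deg_def using e fin by (simp add: sum.remove)
  then have other: "v \<notin># ends G d" if "d \<in> edges G - {e}" for d
    using v a fin that by (auto simp: not_in_iff split: if_splits)
  have av: "a \<noteq> v"
    using v a deg_v by auto
  have D: "deg (H\<lparr>edges := s\<rparr>) x = deg (G\<lparr>edges := s\<rparr>) x" for s x
    by (simp add: H deg_def)
  have D0: "deg (G\<lparr>edges := s\<rparr>) v = 0" if "s \<subseteq> edges G - {e}" for s
    using that other by (auto simp: deg_def not_in_iff intro!: sum.neutral)
  have es: "e \<notin> s" if s: "s \<in> sub_coregraphs G" for s
  proof
    assume es: "e \<in> s"
    have "finite s" using s fin by (auto simp: sub_coregraphs_def intro: finite_subset)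
    then have "deg (G\<lparr>edges := s\<rparr>) v = count (ends G e) v + deg (G\<lparr>edges := s - {e}\<rparr>) v"
      using es by (simp add: deg_def sum.remove)
    then have "deg (G\<lparr>edges := s\<rparr>) v = 1"
      using a av D0[of "s - {e}"] s by (auto simp: sub_coregraphs_def)
    then show False
      using s v by (auto simp: sub_coregraphs_def is_coregraph_def)
  qed
  have V: "verts G = insert v (verts H)" using v by (auto simp: H)
  show "sub_coregraphs H = sub_coregraphs G"
  proof (intro set_eqI iffI)
    fix s assume s: "s \<in> sub_coregraphs H"
    then have "s \<subseteq> edges G - {e}" by (auto simp: sub_coregraphs_def H)
    with s show "s \<in> sub_coregraphs G"
      using D0[of s] by (auto simp: sub_coregraphs_def is_coregraph_def D V)
  next
    fix s assume s: "s \<in> sub_coregraphs G"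
    with es[OF s] show "s \<in> sub_coregraphs H"
      by (auto simp: sub_coregraphs_def is_coregraph_def D V) (auto simp: H)
  qed
  have "card (verts G) > 0" "card (edges G) > 0"
    using v e fin by (auto simp: card_gt_0_iff)
  then show "nullity H = nullity G"
    using v e fin by (simp add: nullity_def H card_Diff_singleton)
  show "connected_mgraph H" if "connected_mgraph G"
  proof (rule connected_retract[OF that, where h = "id(v := a)"])
    fix d x y assume d: "d \<in> edges G" "ends G d = {#x, y#}"
    show "((id(v := a)) x, (id(v := a)) y) \<in> (adjacency H)\<^sup>*"
    proof (cases "d = e")
      case True
      then show ?thesis using d a by (auto simp: add_eq_conv_ex)
    next
      case False
      with d other[of d] have "((id(v := a)) x, (id(v := a)) y) \<in> adjacency H"
        by (auto simp: adjacency_def H intro!: bexI[of _ d])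
      then show ?thesis by blast
    qed
  qed (use a av in \<open>auto simp: H\<close>)
  show "is_cycle G vs es" if "is_cycle H vs es"
    using that by (auto simp: is_cycle_def H)
qed

lemma core_invariants:
  assumes fin: "finite_mgraph G"
  shows "finite_mgraph (core G)" "sub_coregraphs (core G) = sub_coregraphs G"
    "nullity (core G) = nullity G" "connected_mgraph G \<Longrightarrow> connected_mgraph (core G)"
    "is_cycle (core G) vs es \<Longrightarrow> is_cycle G vs es"
proof -
  have "finite_mgraph (core G) \<and> sub_coregraphs (core G) = sub_coregraphs G \<and>
    nullity (core G) = nullity G \<and> (connected_mgraph G \<longrightarrow> connected_mgraph (core G)) \<and>
    (is_cycle (core G) vs es \<longrightarrow> is_cycle G vs es)"
    using clip_core(1)[OF fin]
  proof (induction rule: rtranclp_induct)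
    case base
    then show ?case using fin by simp
  next
    case (step H K)
    then show ?case
      using finite_mgraph_clip[OF step.hyps(2)] clip_invariants[OF step.hyps(2)] by auto
  qed
  then show "finite_mgraph (core G)" "sub_coregraphs (core G) = sub_coregraphs G"
    "nullity (core G) = nullity G" "connected_mgraph G \<Longrightarrow> connected_mgraph (core G)"
    "is_cycle (core G) vs es \<Longrightarrow> is_cycle G vs es"
    by auto
qed

definition is_path :: "('v, 'e) mgraph \<Rightarrow> 'v list \<Rightarrow> 'e list \<Rightarrow> bool" where
  "is_path G vs es \<longleftrightarrow> length vs = Suc (length es) \<and> distinct vs \<and> distinct es \<and>
     set vs \<subseteq> verts G \<and> set es \<subseteq> edges G \<and>
     (\<forall>i<length es. ends G (es ! i) = {#vs ! i, vs ! Suc i#})"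

text \<open>
  The cycle runs along the path from its first vertex to \<open>vs ! j\<close> and returns by \<open>f\<close>. It is enough
  that \<open>f\<close> differs from the first edge of the path, because the later edges miss the first vertex.
\<close>

lemma is_path_close:
  assumes path: "is_path G vs es" and f: "f \<in> edges G" "ends G f = {#vs ! j, vs ! 0#}"
    and j: "j < length vs" and new: "es = [] \<or> f \<noteq> es ! 0"
  shows "is_cycle G (take (Suc j) vs) (take j es @ [f])"
proof -
  have len: "length vs = Suc (length es)" and dv: "distinct vs" and de: "distinct es"
    and sub: "set vs \<subseteq> verts G" "set es \<subseteq> edges G"
    and ends: "\<And>i. i < length es \<Longrightarrow> ends G (es ! i) = {#vs ! i, vs ! Suc i#}"
    using path by (auto simp: is_path_def)
  have l: "length (take j es @ [f]) = Suc j" using j len by simp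
  have "f \<notin> set es"
  proof
    assume "f \<in> set es"
    then obtain i where i: "i < length es" "es ! i = f" by (auto simp: in_set_conv_nth)
    then have "vs ! 0 \<in># {#vs ! i, vs ! Suc i#}" using f by (simp flip: ends)
    then have "i = 0" using i len dv by (auto simp: nth_eq_iff_index_eq)
    then show False using i new by auto
  qed
  then have "f \<notin> set (take j es)" by (meson in_set_takeD)
  then show ?thesis
    unfolding is_cycle_def
  proof (intro conjI allI impI)
    fix i assume "i < length (take j es @ [f])"
    then consider "i < j" | "i = j" using l by linarith
    then show "ends G ((take j es @ [f]) ! i)
        = {#take (Suc j) vs ! i, take (Suc j) vs ! (Suc i mod length (take j es @ [f]))#}"
      using j len ends[of i] f(2) unfolding l by cases (auto simp: nth_append)
  qed (use j len dv de sub f(1) l in \<open>auto dest: in_set_takeD\<close>)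
qed

text \<open>
  The first vertex of a longest path has degree at least 2, hence an edge other than the first one of
  the path. By maximality this edge leads back to the path and closes a cycle.
\<close>

lemma coregraph_has_cycle:
  assumes fin: "finite_mgraph G" and core: "is_coregraph G" and ne: "edges G \<noteq> {}"
  shows "\<exists>vs es. is_cycle G vs es"
proof -
  (* The second conjunct excludes a path that consists of one isolated vertex. *)
  define P where "P = (\<lambda>(vs, es). is_path G vs es \<and> (\<exists>e\<in>edges G. vs ! 0 \<in># ends G e))"
  obtain e where e: "e \<in> edges G" using ne by blast
  then obtain a b where ab: "ends G e = {#a, b#}" "a \<in> verts G"
    using ends_pair[OF fin] by metis
  have "P ([a], [])" using e ab by (auto simp: P_def is_path_def intro!: bexI[of _ e])
  moreover have "length (fst p) < Suc (card (verts G))" if p: "P p" for p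
  proof -
    have "distinct (fst p)" "set (fst p) \<subseteq> verts G"
      using p by (auto simp: P_def is_path_def)
    then show ?thesis
      using card_mono[of "verts G" "set (fst p)"] fin by (simp add: distinct_card finite_mgraph_def)
  qed
  ultimately obtain p where "P p" and max: "\<And>q. P q \<Longrightarrow> length (fst q) \<le> length (fst p)"
    using ex_has_greatest_nat[of P "([a], [])" "\<lambda>p. length (fst p)" "Suc (card (verts G))"] by blast
  then obtain vs es where path: "is_path G vs es" and inc: "\<exists>e\<in>edges G. vs ! 0 \<in># ends G e"
    and p: "p = (vs, es)"
    by (cases p) (auto simp: P_def)
  have len: "length vs = Suc (length es)" and dv: "distinct vs"
    and sub: "set vs \<subseteq> verts G" "set es \<subseteq> edges G"
    and ends: "\<And>i. i < length es \<Longrightarrow> ends G (es ! i) = {#vs ! i, vs ! Suc i#}"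
    using path by (auto simp: is_path_def)
  have "\<exists>f\<in>edges G. vs ! 0 \<in># ends G f \<and> (es = [] \<or> f \<noteq> es ! 0)"
  proof (rule ccontr)
    assume none: "\<not> ?thesis"
    then have es: "es \<noteq> []" using inc by auto
    then have "es ! 0 \<in> edges G" using sub by auto
    then have "deg G (vs ! 0) = count (ends G (es ! 0)) (vs ! 0)
        + (\<Sum>d\<in>edges G - {es ! 0}. count (ends G d) (vs ! 0))"
      unfolding deg_def using fin by (simp add: sum.remove finite_mgraph_def)
    also have "(\<Sum>d\<in>edges G - {es ! 0}. count (ends G d) (vs ! 0)) = 0"
      using none es by (intro sum.neutral) (auto simp: not_in_iff)
    also have "count (ends G (es ! 0)) (vs ! 0) = 1"
      using ends[of 0] es len dv by (auto simp: nth_eq_iff_index_eq)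
    finally have "deg G (vs ! 0) = 1" by simp
    moreover have "vs ! 0 \<in> verts G" using len sub by (auto simp: subset_iff)
    ultimately show False using core by (auto simp: is_coregraph_def)
  qed
  then obtain f where f: "f \<in> edges G" "vs ! 0 \<in># ends G f" "es = [] \<or> f \<noteq> es ! 0" by blast
  then obtain y where y: "ends G f = {#vs ! 0, y#}" "y \<in> verts G"
    using ends_pair_at[OF fin] by metis
  have "y \<in> set vs"
  proof (rule ccontr)
    assume new: "y \<notin> set vs"
    have "f \<notin> set es"
    proof
      assume "f \<in> set es"
      then obtain i where i: "i < length es" "es ! i = f" by (auto simp: in_set_conv_nth)
      then have "y \<in># {#vs ! i, vs ! Suc i#}" using y by (simp flip: ends)
      then show False using new i len by auto
    qed
    then have "P (y # vs, f # es)"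
      using path f y new
      by (auto simp: P_def is_path_def nth_Cons add_mset_commute intro!: bexI[of _ f] split: nat.splits)
    then show False using max p by fastforce
  qed
  then obtain j where "j < length vs" "vs ! j = y" by (auto simp: in_set_conv_nth)
  then show ?thesis
    using is_path_close[OF path f(1), of j] f(3) y by (auto simp: add_mset_commute)
qed

text \<open>
  Each vertex is met by the list of first ends as often as by the list of second ends, since one is a
  rotation of the other. So all degrees are even.
\<close>

lemma cycle_sub_coregraph:
  assumes "is_cycle G vs es"
  shows "set es \<in> sub_coregraphs G"
proof -
  have "even (deg (G\<lparr>edges := set es\<rparr>) v)" for v
  proof -
    obtain m where m: "length es = Suc m"
      using assms by (cases es) (auto simp: is_cycle_def)
    define g where "g i = (if vs ! i = v then 1 else 0 :: nat)" for i
    have "deg (G\<lparr>edges := set es\<rparr>) v = sum_list (map (\<lambda>e. count (ends G e) v) es)"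
      using assms by (simp add: deg_def is_cycle_def sum_list_distinct_conv_sum_set)
    also have "\<dots> = (\<Sum>i<Suc m. count (ends G (es ! i)) v)"
      using m by (simp add: sum_list_sum_nth atLeast0LessThan)
    also have "\<dots> = (\<Sum>i<Suc m. g i + g (Suc i mod Suc m))"
      using assms m by (intro sum.cong refl) (auto simp: is_cycle_def g_def)
    also have "(\<Sum>i<Suc m. g (Suc i mod Suc m)) = (\<Sum>i<Suc m. g i)"
      unfolding sum.lessThan_Suc_shift[of g] by simp
    then have "(\<Sum>i<Suc m. g i + g (Suc i mod Suc m)) = 2 * (\<Sum>i<Suc m. g i)"
      by (simp only: sum.distrib mult_2)
    finally show ?thesis by simp
  qed
  then have "deg (G\<lparr>edges := set es\<rparr>) v \<noteq> 1" for v
    by (metis odd_one)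
  then show ?thesis
    using assms by (simp add: sub_coregraphs_def is_coregraph_def is_cycle_def)
qed

lemma golden_powi_minus_1: "((5 - sqrt 5) / 2) powi - 1 + ((5 + sqrt 5) / 2) powi - 1 = 1"
proof -
  have "(5 - sqrt 5) * (5 + sqrt 5) = 20" by (simp add: algebra_simps)
  moreover have "sqrt 5 < 5" by (rule real_less_lsqrt) auto
  moreover have "0 < 5 + sqrt 5" by (simp add: add_pos_nonneg)
  ultimately show ?thesis
    by (simp add: power_int_minus add_frac_eq)
qed

lemma connected_edgeless:
  assumes "connected_mgraph G" "edges G = {}"
  obtains v where "verts G = {v}"
proof -
  obtain v where v: "v \<in> verts G" using assms by (auto simp: connected_mgraph_def)
  then have "x = v" if "x \<in> verts G" for x
    using connected_leaving_edge[OF assms(1) v that] assms(2) by auto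
  with v have "verts G = {v}" by blast
  then show ?thesis by (rule that)
qed

text \<open>
  A tree has an acyclic core, which has no edges. Conversely, the upper bound for nullity 0 is 1, so
  the empty set is the only sub-coregraph and there is no cycle.
\<close>

lemma is_tree_iff_nullity:
  assumes fin: "finite_mgraph G" and con: "connected_mgraph G"
  shows "is_tree G \<longleftrightarrow> nullity G = 0"
proof
  note core = core_invariants[OF fin]
  assume "is_tree G"
  then have "edges (core G) = {}"
    using coregraph_has_cycle[OF core(1) clip_core(2)[OF fin]] core(5) by (auto simp: is_tree_def)
  moreover then obtain v where "verts (core G) = {v}"
    using connected_edgeless[OF core(4)[OF con]] by metis
  ultimately show "nullity G = 0"
    using core(3) by (simp add: nullity_def)
next
  assume n: "nullity G = 0"
  have "card (sub_coregraphs G) \<le> 1"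
    using card_sub_coregraphs_upper[OF fin con] golden_powi_minus_1 n by simp
  moreover have "{} \<in> sub_coregraphs G"
    by (auto simp: sub_coregraphs_def is_coregraph_def deg_def)
  ultimately have only: "s = {}" if "s \<in> sub_coregraphs G" for s
    using that card_le_Suc0_iff_eq[OF finite_sub_coregraphs[OF fin]] by auto
  show "is_tree G"
    unfolding is_tree_def
  proof (intro conjI notI con)
    assume "\<exists>vs es. is_cycle G vs es"
    then obtain vs es where c: "is_cycle G vs es" by blast
    show False using only[OF cycle_sub_coregraph[OF c]] c by (simp add: is_cycle_def)
  qed
qed

section \<open>Isomorphism and subdivision\<close>

lemma count_image_mset_inj_on:
  assumes "inj_on f A" "set_mset M \<subseteq> A" "x \<in> A"
  shows "count (image_mset f M) (f x) = count M x"
  using assms(2)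
proof (induction M)
  case (add y M)
  then have "f y = f x \<longleftrightarrow> y = x"
    using inj_on_eq_iff[OF assms(1)] assms(3) by auto
  then show ?case using add by auto
qed simp

lemma mgraph_iso_deg:
  assumes fin: "finite_mgraph G" and f: "inj_on f (verts G)" and g: "inj_on g (edges G)"
    and ends: "\<And>e. e \<in> edges G \<Longrightarrow> ends H (g e) = image_mset f (ends G e)"
    and s: "s \<subseteq> edges G" and v: "v \<in> verts G"
  shows "deg (H\<lparr>edges := g ` s\<rparr>) (f v) = deg (G\<lparr>edges := s\<rparr>) v"
proof -
  have "deg (H\<lparr>edges := g ` s\<rparr>) (f v) = (\<Sum>e\<in>s. count (ends H (g e)) (f v))"
    using inj_on_subset[OF g s] by (simp add: deg_def sum.reindex)
  also have "\<dots> = (\<Sum>e\<in>s. count (ends G e) v)"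
  proof (rule sum.cong[OF refl])
    fix e assume "e \<in> s"
    then have e: "e \<in> edges G" using s by blast
    then have "set_mset (ends G e) \<subseteq> verts G" using fin by (auto simp: finite_mgraph_def)
    then show "count (ends H (g e)) (f v) = count (ends G e) v"
      by (simp add: ends[OF e] count_image_mset_inj_on[OF f _ v])
  qed
  finally show ?thesis by (simp add: deg_def)
qed

lemma mgraph_iso_invariants:
  assumes fin: "finite_mgraph G" and iso: "mgraph_iso G H"
  shows "card (sub_coregraphs H) = card (sub_coregraphs G)" "nullity H = nullity G"
    "deg H ` verts H = deg G ` verts G"
proof -
  obtain f g where f: "bij_betw f (verts G) (verts H)" and g: "bij_betw g (edges G) (edges H)"
    and ends: "\<And>e. e \<in> edges G \<Longrightarrow> ends H (g e) = image_mset f (ends G e)"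
    using iso by (auto simp: mgraph_iso_def)
  have D: "deg (H\<lparr>edges := g ` s\<rparr>) (f v) = deg (G\<lparr>edges := s\<rparr>) v"
    if "s \<subseteq> edges G" "v \<in> verts G" for s v
    using mgraph_iso_deg[OF fin bij_betw_imp_inj_on[OF f] bij_betw_imp_inj_on[OF g] ends that] .
  have V: "verts H = f ` verts G" and E: "edges H = g ` edges G"
    using f g by (auto simp: bij_betw_def)
  have "sub_coregraphs H = image g ` sub_coregraphs G"
    using D by (auto simp: sub_coregraphs_def is_coregraph_def V E image_iff subset_image_iff)
  moreover have "inj_on (image g) (sub_coregraphs G)"
    using inj_on_image_Pow[OF bij_betw_imp_inj_on[OF g]]
    by (rule inj_on_subset) (auto simp: sub_coregraphs_def)
  ultimately show "card (sub_coregraphs H) = card (sub_coregraphs G)"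
    by (simp add: card_image)
  show "nullity H = nullity G"
    using bij_betw_same_card[OF f] bij_betw_same_card[OF g] by (simp add: nullity_def)
  have "deg H (f v) = deg G v" if "v \<in> verts G" for v
    using D[OF subset_refl that] by (simp add: deg_def E)
  then show "deg H ` verts H = deg G ` verts G"
    by (auto simp: V image_iff)
qed

text \<open>
  The new vertex has degree 2, so a sub-coregraph of \<open>H\<close> contains both halves of the subdivided edge
  or neither. Exchanging the two halves for the edge is a bijection between the sub-coregraphs.
\<close>

lemma subdivide_invariants:
  assumes "subdivide G H" and fin: "finite_mgraph G"
  shows "finite_mgraph H" "card (sub_coregraphs H) = card (sub_coregraphs G)"
    "nullity H = nullity G" "verts G \<subseteq> verts H"
    "\<And>x. x \<in> verts G \<Longrightarrow> deg H x = deg G x"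
    "\<And>x. x \<in> verts H - verts G \<Longrightarrow> deg H x = 2"
proof -
  from assms(1) obtain e u v w e1 e2 where e: "e \<in> edges G" "ends G e = {#u, v#}"
    and w: "w \<notin> verts G" and e12: "e1 \<notin> edges G - {e}" "e2 \<notin> edges G - {e}" "e1 \<noteq> e2"
    and H: "H = G\<lparr>verts := insert w (verts G), edges := insert e1 (insert e2 (edges G - {e})),
                    ends := (ends G)(e1 := {#u, w#}, e2 := {#w, v#})\<rparr>"
    by (rule subdivide.cases)
  have uv: "u \<in> verts G" "v \<in> verts G" and finV: "finite (verts G)" and finE: "finite (edges G)"
    using fin e by (auto simp: finite_mgraph_def)
  show fH: "finite_mgraph H"
    using fin uv e12 by (auto simp: finite_mgraph_def H)
  have w0: "count (ends G d) w = 0" if "d \<in> edges G" for d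
    using fin w that by (auto simp: finite_mgraph_def not_in_iff[symmetric])
  let ?G = "\<lambda>s. deg (G\<lparr>edges := s\<rparr>)" and ?H = "\<lambda>s. deg (H\<lparr>edges := s\<rparr>)"
  have DH: "?H s x = ?G s x" if "s \<subseteq> edges G - {e}" for s x
    using that e12 by (auto simp: deg_def H intro!: sum.cong)
  have D12: "?H (insert e1 (insert e2 s)) x = count {#u, w, w, v#} x + ?G s x"
      "?H (insert e1 s) x = count {#u, w#} x + ?G s x"
      "?H (insert e2 s) x = count {#w, v#} x + ?G s x"
      "?G (insert e s) x = count {#u, v#} x + ?G s x" if s: "s \<subseteq> edges G - {e}" for s x
  proof -
    have "finite s" "e1 \<notin> s" "e2 \<notin> s" "e \<notin> s"
      using s finE e12 by (auto intro: finite_subset)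
    then show "?H (insert e1 (insert e2 s)) x = count {#u, w, w, v#} x + ?G s x"
      "?H (insert e1 s) x = count {#u, w#} x + ?G s x"
      "?H (insert e2 s) x = count {#w, v#} x + ?G s x"
      "?G (insert e s) x = count {#u, v#} x + ?G s x"
      unfolding DH[OF s, symmetric] using DH[OF s] e12 e by (auto simp: deg_edges_update H)
  qed
  have Dw: "?G s w = 0" if "s \<subseteq> edges G" for s
    using that w0 by (auto simp: deg_edges_update intro!: sum.neutral)
  have full: "?H (edges H) x = count {#u, w, w, v#} x + ?G (edges G - {e}) x"
      "?G (edges G) x = count {#u, v#} x + ?G (edges G - {e}) x" for x
    using D12(1,4)[OF subset_refl, of x] e by (simp_all add: H insert_absorb)
  have same: "G\<lparr>edges := edges G\<rparr> = G" "H\<lparr>edges := edges H\<rparr> = H" by simp_all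
  show "deg H x = deg G x" if "x \<in> verts G" for x
    using full[of x] that w by (auto simp: same)
  show "deg H x = 2" if "x \<in> verts H - verts G" for x
  proof -
    have "x = w" "u \<noteq> w" "v \<noteq> w" using that w uv by (auto simp: H)
    then show ?thesis using full(1)[of w] Dw[of "edges G - {e}"] by (auto simp: same)
  qed
  show "verts G \<subseteq> verts H" by (auto simp: H)
  have "card (edges G - {e}) = card (edges G) - 1" "card (edges G) > 0"
    using e finE by (auto simp: card_gt_0_iff)
  then show "nullity H = nullity G"
    using w e12 finV finE by (simp add: nullity_def H)
  (* One half may reuse the name e, so the old edge is removed before the halves are inserted. *)
  define \<phi> where "\<phi> s = (if e \<in> s then insert e1 (insert e2 (s - {e})) else s)" for s
  define \<psi> where "\<psi> t = (if e1 \<in> t then insert e (t - {e1, e2}) else t)" for t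
  have eqdeg: "?H (\<phi> s) x = ?G s x" if "s \<subseteq> edges G" "x \<in> verts G" for s x
  proof (cases "e \<in> s")
    case True
    then have "insert e (s - {e}) = s" "s - {e} \<subseteq> edges G - {e}" using that by blast+
    then show ?thesis
      using D12(1,4)[of "s - {e}" x] True that w by (auto simp: \<phi>_def)
  next
    case False
    then have "s \<subseteq> edges G - {e}" using that by blast
    then show ?thesis using DH[of s x] False by (simp add: \<phi>_def)
  qed
  have eqw: "?H (\<phi> s) w \<noteq> 1" if "s \<subseteq> edges G" for s
  proof (cases "e \<in> s")
    case True
    moreover have "s - {e} \<subseteq> edges G - {e}" using that by blast
    ultimately show ?thesis using D12(1)[of "s - {e}" w] that by (auto simp: \<phi>_def)
  next
    case False
    then have "s \<subseteq> edges G - {e}" using that by blast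
    then show ?thesis using DH[of s w] Dw[OF that] False by (simp add: \<phi>_def)
  qed
  have sub\<phi>: "\<phi> s \<subseteq> edges H" if "s \<subseteq> edges G" for s
    using that by (auto simp: \<phi>_def H)
  have \<psi>\<phi>: "\<psi> (\<phi> s) = s" if "s \<subseteq> edges G" for s
    using that e12 by (auto simp: \<phi>_def \<psi>_def)
  have iff: "\<phi> s \<in> sub_coregraphs H \<longleftrightarrow> s \<in> sub_coregraphs G" if "s \<subseteq> edges G" for s
    using that eqdeg eqw sub\<phi> by (auto simp: sub_coregraphs_def is_coregraph_def) (auto simp: H)
  have \<phi>\<psi>: "\<phi> (\<psi> t) = t \<and> \<psi> t \<subseteq> edges G" if t: "t \<in> sub_coregraphs H" for t
  proof -
    have tH: "t \<subseteq> edges H" and tw: "?H t w \<noteq> 1"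
      using t by (auto simp: sub_coregraphs_def is_coregraph_def H)
    define r where "r = t - {e1, e2}"
    have r: "r \<subseteq> edges G - {e}" using tH by (auto simp: r_def H)
    have rw: "?G r w = 0" using r by (intro Dw) auto
    have "e1 \<in> t \<longleftrightarrow> e2 \<in> t"
    proof (rule ccontr)
      assume "(e1 \<in> t) \<noteq> (e2 \<in> t)"
      then have "t = insert e1 r \<or> t = insert e2 r" by (auto simp: r_def)
      then have "?H t w = 1" using D12(2,3)[OF r, of w] rw w uv by auto
      then show False using tw by simp
    qed
    then show ?thesis
      using r e tH by (auto simp: \<phi>_def \<psi>_def r_def H)
  qed
  have "bij_betw \<phi> (sub_coregraphs G) (sub_coregraphs H)"
  proof (rule bij_betw_byWitness[where f' = \<psi>])
    show "\<forall>s\<in>sub_coregraphs G. \<psi> (\<phi> s) = s"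
      using \<psi>\<phi> by (auto simp: sub_coregraphs_def)
    show "\<phi> ` sub_coregraphs G \<subseteq> sub_coregraphs H"
      using iff by (auto simp: sub_coregraphs_def)
    show "\<psi> ` sub_coregraphs H \<subseteq> sub_coregraphs G"
      using \<phi>\<psi> iff by force
  qed (use \<phi>\<psi> in blast)
  then show "card (sub_coregraphs H) = card (sub_coregraphs G)"
    by (metis bij_betw_same_card)
qed

lemma subdivisions_invariants:
  assumes "subdivide\<^sup>*\<^sup>* G H" and fin: "finite_mgraph G"
  shows "finite_mgraph H" "card (sub_coregraphs H) = card (sub_coregraphs G)"
    "nullity H = nullity G" "verts G \<subseteq> verts H"
    "\<And>x. x \<in> verts G \<Longrightarrow> deg H x = deg G x"
    "\<And>x. x \<in> verts H - verts G \<Longrightarrow> deg H x = 2"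
proof -
  have "finite_mgraph H \<and> card (sub_coregraphs H) = card (sub_coregraphs G) \<and>
    nullity H = nullity G \<and> verts G \<subseteq> verts H \<and>
    (\<forall>x\<in>verts G. deg H x = deg G x) \<and> (\<forall>x\<in>verts H - verts G. deg H x = 2)"
    using assms(1)
  proof (induction rule: rtranclp_induct)
    case base
    then show ?case using fin by simp
  next
    case (step H K)
    then have fH: "finite_mgraph H" by blast
    note inv = subdivide_invariants[OF step.hyps(2) fH]
    have "deg K x = deg G x" if "x \<in> verts G" for x
      using inv(5)[of x] step.IH that by (metis subsetD)
    moreover have "deg K x = 2" if "x \<in> verts K - verts G" for x
      using inv(5,6)[of x] step.IH that by (metis DiffD1 DiffD2 DiffI)
    ultimately show ?case
      using step.IH inv(1-4) by (metis order_trans)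
  qed
  then show "finite_mgraph H" "card (sub_coregraphs H) = card (sub_coregraphs G)"
    "nullity H = nullity G" "verts G \<subseteq> verts H"
    "\<And>x. x \<in> verts G \<Longrightarrow> deg H x = deg G x"
    "\<And>x. x \<in> verts H - verts G \<Longrightarrow> deg H x = 2"
    by auto
qed

text \<open>
  A second vertex \<open>z\<close> and connectivity exclude a loop at \<open>w\<close>. So \<open>w\<close> lies on two non-loop edges \<open>e1\<close>
  and \<open>e2\<close>, which are joined into one edge that keeps the name \<open>e1\<close>.
\<close>

lemma unsubdivide:
  assumes fin: "finite_mgraph G" and con: "connected_mgraph G"
    and w: "w \<in> verts G" "deg G w = 2" and z: "z \<in> verts G" "z \<noteq> w"
  obtains R where "subdivide R G" "finite_mgraph R" "connected_mgraph R" "verts R = verts G - {w}"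
proof -
  have finE: "finite (edges G)" using fin by (simp add: finite_mgraph_def)
  obtain e1 u where e1: "e1 \<in> edges G" "ends G e1 = {#w, u#}" "u \<noteq> w"
    using connected_leaving_edge[OF con w(1) z(1)] z(2) by metis
  have "deg G w = count (ends G e1) w + (\<Sum>d\<in>edges G - {e1}. count (ends G d) w)"
    unfolding deg_def using e1 finE by (simp add: sum.remove)
  then have rest: "(\<Sum>d\<in>edges G - {e1}. count (ends G d) w) = 1"
    using w e1 by auto
  then obtain e2 where e2: "e2 \<in> edges G - {e1}" "w \<in># ends G e2"
    by (metis (no_types, lifting) count_eq_zero_iff sum.neutral zero_neq_one)
  then obtain v where v: "ends G e2 = {#w, v#}"
    using ends_pair_at[OF fin, of e2 w] by auto
  have "(\<Sum>d\<in>edges G - {e1}. count (ends G d) w) =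
      count (ends G e2) w + (\<Sum>d\<in>edges G - {e1} - {e2}. count (ends G d) w)"
    using e2 finE by (simp add: sum.remove)
  with rest v finE have vw: "v \<noteq> w" and other0: "\<forall>d\<in>edges G - {e1} - {e2}. count (ends G d) w = 0"
    by (auto split: if_splits)
  then have other: "w \<notin># ends G d" if "d \<in> edges G" "d \<noteq> e1" "d \<noteq> e2" for d
    using that by (auto simp: not_in_iff)
  have uv: "u \<in> verts G" "v \<in> verts G"
    using fin e1 e2 v by (auto simp: finite_mgraph_def)
  define R where "R = \<lparr>verts = verts G - {w}, edges = edges G - {e2}, ends = (ends G)(e1 := {#u, v#})\<rparr>"
  have "subdivide R (R\<lparr>verts := insert w (verts R), edges := insert e1 (insert e2 (edges R - {e1})),
      ends := (ends R)(e1 := {#u, w#}, e2 := {#w, v#})\<rparr>)"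
    by (rule subdivide.intros) (use e1 e2 in \<open>auto simp: R_def\<close>)
  moreover have "R\<lparr>verts := insert w (verts R), edges := insert e1 (insert e2 (edges R - {e1})),
      ends := (ends R)(e1 := {#u, w#}, e2 := {#w, v#})\<rparr> = G"
    by (rule mgraph.equality) (use e1 e2 v w in \<open>auto simp: R_def fun_eq_iff add_mset_commute\<close>)
  ultimately have "subdivide R G" by simp
  moreover have "finite_mgraph R"
    using fin uv e1 vw other by (auto simp: finite_mgraph_def R_def)
  moreover have "connected_mgraph R"
  proof (rule connected_retract[OF con, where h = "id(w := u)"])
    have uvR: "(u, v) \<in> adjacency R" "(v, u) \<in> adjacency R"
      using e1 e2 by (auto simp: adjacency_def R_def add_mset_commute)
    fix d x y assume d: "d \<in> edges G" "ends G d = {#x, y#}"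
    consider "d = e1" | "d = e2" | "d \<noteq> e1" "d \<noteq> e2" by blast
    then show "((id(w := u)) x, (id(w := u)) y) \<in> (adjacency R)\<^sup>*"
    proof cases
      case 1
      then show ?thesis using d e1 by (auto simp: add_eq_conv_ex)
    next
      case 2
      then show ?thesis using d v vw uvR by (auto simp: add_eq_conv_ex)
    next
      case 3
      with d other[of d] have "((id(w := u)) x, (id(w := u)) y) \<in> adjacency R"
        by (auto simp: adjacency_def R_def intro!: bexI[of _ d])
      then show ?thesis by blast
    qed
  qed (use uv e1 in \<open>auto simp: R_def\<close>)
  ultimately show ?thesis using that by (simp add: R_def)
qed

lemma exists_unsubdivided:
  assumes "finite_mgraph G" "connected_mgraph G"
  shows "\<exists>R. subdivide\<^sup>*\<^sup>* R G \<and> finite_mgraph R \<and> connected_mgraph R \<and>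
    ((\<exists>v. verts R = {v}) \<or> (\<forall>v\<in>verts R. deg R v \<noteq> 2))"
  using assms
proof (induction "card (verts G)" arbitrary: G rule: less_induct)
  case less
  show ?case
  proof (cases "(\<exists>v. verts G = {v}) \<or> (\<forall>v\<in>verts G. deg G v \<noteq> 2)")
    case True
    then show ?thesis using less.prems by blast
  next
    case False
    then obtain w where w: "w \<in> verts G" "deg G w = 2" by blast
    with False obtain z where z: "z \<in> verts G" "z \<noteq> w" by blast
    obtain R where R: "subdivide R G" "finite_mgraph R" "connected_mgraph R" "verts R = verts G - {w}"
      using unsubdivide[OF less.prems w z] .
    have "card (verts R) < card (verts G)"
      unfolding R(4) using less.prems(1) w by (intro card_Diff1_less) (simp_all add: finite_mgraph_def)
    from less.hyps[OF this R(2,3)] R(1) show ?thesis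
      by (meson rtranclp.rtrancl_into_rtrancl)
  qed
qed

lemma bij_betw_fun_upd:
  assumes "bij_betw f A B" "a \<notin> A" "b \<notin> B"
  shows "bij_betw (f(a := b)) (insert a A) (insert b B)"
proof -
  have "bij_betw (f(a := b)) A B"
    using assms(1,2) bij_betw_cong[of A f "f(a := b)" B] by (metis fun_upd_other)
  then show ?thesis
    using notIn_Un_bij_betw[of a A "f(a := b)" B] assms(2,3) by simp
qed

text \<open>
  A graph on natural numbers always has room for one more vertex and two more edges, which is all
  that is needed to imitate a subdivision of an isomorphic graph.
\<close>

lemma subdivide_transport:
  fixes B :: "(nat, nat) mgraph"
  assumes iso: "mgraph_iso B R" and fin: "finite_mgraph B" and sub: "subdivide R S"
  shows "\<exists>B'. subdivide B B' \<and> mgraph_iso B' S"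
proof -
  obtain f g where f: "bij_betw f (verts B) (verts R)" and g: "bij_betw g (edges B) (edges R)"
    and ends: "\<And>e. e \<in> edges B \<Longrightarrow> ends R (g e) = image_mset f (ends B e)"
    using iso by (auto simp: mgraph_iso_def)
  from sub obtain e u v w e1 e2 where e: "e \<in> edges R" "ends R e = {#u, v#}"
    and w: "w \<notin> verts R" and e12: "e1 \<notin> edges R - {e}" "e2 \<notin> edges R - {e}" "e1 \<noteq> e2"
    and S: "S = R\<lparr>verts := insert w (verts R), edges := insert e1 (insert e2 (edges R - {e})),
                    ends := (ends R)(e1 := {#u, w#}, e2 := {#w, v#})\<rparr>"
    by (rule subdivide.cases)
  obtain d where d: "d \<in> edges B" "g d = e"
    using g e by (metis bij_betw_imp_surj_on imageE)
  then have "image_mset f (ends B d) = {#u, v#}" using ends e by auto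
  moreover obtain a b where "ends B d = {#a, b#}"
    using ends_pair[OF fin d(1)] .
  ultimately obtain u' v' where uv': "ends B d = {#u', v'#}" "f u' = u" "f v' = v"
    by (auto simp: add_eq_conv_ex add_mset_commute)
  have uvB: "u' \<in> verts B" "v' \<in> verts B"
    using fin d uv' by (auto simp: finite_mgraph_def)
  have "finite (verts B)" "finite (edges B)" using fin by (auto simp: finite_mgraph_def)
  then obtain w' d1 where w': "w' \<notin> verts B" and d1: "d1 \<notin> edges B"
    using ex_new_if_finite infinite_UNIV_nat by metis
  obtain d2 where d2: "d2 \<notin> insert d1 (edges B)"
    using ex_new_if_finite[of "insert d1 (edges B)"] \<open>finite (edges B)\<close> by auto
  define B' where "B' = B\<lparr>verts := insert w' (verts B), edges := insert d1 (insert d2 (edges B - {d})),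
                    ends := (ends B)(d1 := {#u', w'#}, d2 := {#w', v'#})\<rparr>"
  have "subdivide B B'"
    unfolding B'_def by (rule subdivide.intros) (use d uv' w' d1 d2 in auto)
  moreover have "mgraph_iso B' S"
    unfolding mgraph_iso_def
  proof (intro exI conjI ballI)
    have gd: "bij_betw g (edges B - {d}) (edges R - {e})"
      using g d by (auto simp: bij_betw_def inj_on_def)
    show "bij_betw (f(w' := w)) (verts B') (verts S)"
      using bij_betw_fun_upd[OF f w' w] by (simp add: B'_def S)
    show "bij_betw (g(d1 := e1, d2 := e2)) (edges B') (edges S)"
    proof -
      have "bij_betw ((g(d2 := e2))(d1 := e1)) (insert d1 (insert d2 (edges B - {d})))
          (insert e1 (insert e2 (edges R - {e})))"
        by (intro bij_betw_fun_upd gd) (use d1 d2 e12 in auto)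
      moreover have "(g(d2 := e2))(d1 := e1) = g(d1 := e1, d2 := e2)"
        using d2 by (intro fun_upd_twist) auto
      ultimately show ?thesis by (simp add: B'_def S)
    qed
    fix c assume c: "c \<in> edges B'"
    consider "c = d1" | "c = d2" | "c \<in> edges B - {d}" "c \<noteq> d1" "c \<noteq> d2"
      using c d1 d2 by (auto simp: B'_def)
    then show "ends S ((g(d1 := e1, d2 := e2)) c) = image_mset (f(w' := w)) (ends B' c)"
    proof cases
      case 3
      then have "g c \<in> edges R - {e}" using gd by (auto simp: bij_betw_def)
      moreover have "w' \<notin># ends B c"
        using 3 fin w' by (auto simp: finite_mgraph_def)
      then have "image_mset (f(w' := w)) (ends B c) = image_mset f (ends B c)"
        by (intro image_mset_cong) auto
      ultimately show ?thesis
        using 3 e12 ends[of c] by (auto simp: B'_def S)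
    qed (use d1 d2 e12 w' uvB uv' in \<open>auto simp: B'_def S\<close>)
  qed
  ultimately show ?thesis by blast
qed

lemma subdivision_transport:
  fixes B :: "(nat, nat) mgraph"
  assumes iso: "mgraph_iso B R" and fin: "finite_mgraph B" and sub: "subdivide\<^sup>*\<^sup>* R S"
  shows "is_subdivision_of S B"
proof -
  have "\<exists>B'. subdivide\<^sup>*\<^sup>* B B' \<and> mgraph_iso B' S"
    using sub
  proof (induction rule: rtranclp_induct)
    case base
    then show ?case using iso by blast
  next
    case (step S T)
    then obtain B' where B': "subdivide\<^sup>*\<^sup>* B B'" "mgraph_iso B' S" by blast
    then show ?case
      using subdivide_transport[OF B'(2) subdivisions_invariants(1)[OF B'(1) fin] step.hyps(2)]
      by (meson rtranclp.rtrancl_into_rtrancl)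
  qed
  then show ?thesis by (auto simp: is_subdivision_of_def)
qed

text \<open>
  Together with \<open>subdivision_transport\<close> this allows subdivisions to be taken apart over arbitrary types
  and restated over the natural numbers.
\<close>

lemma nat_copy:
  assumes fin: "finite_mgraph R"
  obtains B :: "(nat, nat) mgraph" where "finite_mgraph B" "mgraph_iso B R"
proof -
  obtain f where f: "bij_betw f {0..<card (verts R)} (verts R)"
    using ex_bij_betw_nat_finite[of "verts R"] fin by (metis finite_mgraph_def)
  obtain g where g: "bij_betw g {0..<card (edges R)} (edges R)"
    using ex_bij_betw_nat_finite[of "edges R"] fin by (metis finite_mgraph_def)
  define f' where "f' = inv_into {0..<card (verts R)} f"
  have f': "f' x \<in> {0..<card (verts R)}" "f (f' x) = x" if "x \<in> verts R" for x
    using inv_into_into[of x f "{0..<card (verts R)}"] f_inv_into_f[of x f "{0..<card (verts R)}"]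
      that bij_betw_imp_surj_on[OF f] unfolding f'_def by simp_all
  define B where "B = \<lparr>verts = {0..<card (verts R)}, edges = {0..<card (edges R)},
    ends = (\<lambda>i. image_mset f' (ends R (g i)))\<rparr>"
  have gR: "size (ends R (g i)) = 2" "set_mset (ends R (g i)) \<subseteq> verts R" if "i < card (edges R)" for i
    using fin bij_betwE[OF g] that by (simp_all add: finite_mgraph_def)
  have "finite_mgraph B"
    unfolding finite_mgraph_def
  proof (intro conjI ballI)
    fix i assume "i \<in> edges B"
    then have i: "i < card (edges R)" by (simp add: B_def)
    show "size (ends B i) = 2" using gR(1)[OF i] by (simp add: B_def)
    show "set_mset (ends B i) \<subseteq> verts B"
      using gR(2)[OF i] f'(1) by (auto simp: B_def)
  qed (simp_all add: B_def)
  moreover have "mgraph_iso B R"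
    unfolding mgraph_iso_def
  proof (intro exI conjI ballI)
    fix i assume "i \<in> edges B"
    then have "set_mset (ends R (g i)) \<subseteq> verts R" using gR by (simp add: B_def)
    then have "image_mset (f \<circ> f') (ends R (g i)) = image_mset id (ends R (g i))"
      using f'(2) by (intro image_mset_cong) auto
    then show "ends R (g i) = image_mset f (ends B i)"
      by (simp add: B_def multiset.map_comp)
  qed (use f g in \<open>auto simp: B_def\<close>)
  ultimately show ?thesis by (rule that)
qed

lemma finite_bouquet: "finite_mgraph (bouquet n)"
  by (simp add: finite_mgraph_def bouquet_def)

lemma bouquet_iso:
  assumes fin: "finite_mgraph R" and V: "verts R = {v}"
  shows "mgraph_iso (bouquet (card (edges R))) R"
proof -
  obtain g where g: "bij_betw g {0..<card (edges R)} (edges R)"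
    using ex_bij_betw_nat_finite[of "edges R"] fin by (metis finite_mgraph_def)
  have "ends R e = {#v, v#}" if e: "e \<in> edges R" for e
    by (rule ends_pair[OF fin e]) (use V in auto)
  then show ?thesis
    using g V unfolding mgraph_iso_def bouquet_def
    by (intro exI[of _ "\<lambda>_. v"] exI[of _ g]) (auto simp: atLeast0LessThan bij_betw_def)
qed

lemma card_sub_coregraphs_bouquet: "card (sub_coregraphs (bouquet n)) = 2 ^ n"
proof -
  have "sub_coregraphs (bouquet n) = Pow {..<n}"
    by (auto simp: sub_coregraphs_def is_coregraph_def bouquet_def deg_def simp flip: mult_2)
  then show ?thesis by (simp add: card_Pow)
qed

section \<open>The extremal graphs\<close>

text \<open>
  Suppress all vertices of degree 2. If two vertices were left, all degrees would be even and
  different from 0 and 2, hence at least 4. Removing a non-loop edge then leaves degrees of at least 3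
  and an odd one among them, although every sub-coregraph is even.
\<close>

lemma lower_eq_imp_bouquet:
  assumes fin: "finite_mgraph H" and con: "connected_mgraph H" and core: "is_coregraph H"
    and eq: "real (card (sub_coregraphs H)) = 2 powi nullity H"
  shows "\<exists>n. is_subdivision_of H (bouquet n)"
proof -
  obtain R where R: "subdivide\<^sup>*\<^sup>* R H" "finite_mgraph R" "connected_mgraph R"
    and red: "(\<exists>v. verts R = {v}) \<or> (\<forall>v\<in>verts R. deg R v \<noteq> 2)"
    using exists_unsubdivided[OF fin con] by blast
  note inv = subdivisions_invariants[OF R(1,2)]
  have finE: "finite (edges R)" using R(2) by (simp add: finite_mgraph_def)
  have "\<exists>v. verts R = {v}"
  proof (rule ccontr)
    assume many: "\<not> ?thesis"
    with red have no2: "\<forall>v\<in>verts R. deg R v \<noteq> 2" by blast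
    have other: "\<exists>x\<in>verts R. v \<noteq> x" if v: "v \<in> verts R" for v
    proof (rule ccontr)
      assume "\<not> (\<exists>x\<in>verts R. v \<noteq> x)"
      then have "x = v" if "x \<in> verts R" for x using that by metis
      then have "verts R = {v}" using v by blast
      then show False using many by blast
    qed
    note even = card_sub_coregraphs_lower_eq[OF R(2,3) eq[unfolded inv(2,3)]]
    have coreR: "is_coregraph R"
      using core inv(4,5) by (force simp: is_coregraph_def)
    have ge4: "deg R v \<ge> 4" if v: "v \<in> verts R" for v
    proof -
      obtain x where x: "x \<in> verts R" "v \<noteq> x" using other[OF v] by blast
      obtain e y where "e \<in> edges R" "ends R e = {#v, y#}"
        using connected_leaving_edge[OF R(3) v x] .
      then have "deg R v \<noteq> 0" using deg_eq_0_iff[OF R(2), of v] by auto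
      moreover have "even (deg R v)"
        using even[OF _ v, of "edges R"] coreR by (simp add: sub_coregraphs_def)
      moreover have "deg R v \<noteq> 2" using no2 v by blast
      ultimately show ?thesis by presburger
    qed
    obtain v where v: "v \<in> verts R" using R(3) by (auto simp: connected_mgraph_def)
    then obtain x where x: "x \<in> verts R" "v \<noteq> x" using other by blast
    obtain e y where e: "e \<in> edges R" "ends R e = {#v, y#}" "y \<noteq> v"
      using connected_leaving_edge[OF R(3) v x] .
    have D: "deg R a = count {#v, y#} a + deg (R\<lparr>edges := edges R - {e}\<rparr>) a" for a
      using e finE by (simp add: deg_def sum.remove)
    have "edges R - {e} \<in> sub_coregraphs R"
      unfolding sub_coregraphs_def is_coregraph_def
    proof (intro CollectI conjI ballI)
      fix a assume "a \<in> verts (R\<lparr>edges := edges R - {e}\<rparr>)"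
      then have "deg R a \<ge> 4" using ge4 by simp
      then show "deg (R\<lparr>edges := edges R - {e}\<rparr>) a \<noteq> 1"
        using D[of a] e(3) by (auto split: if_splits)
    qed auto
    from even[OF this v] have "even (deg (R\<lparr>edges := edges R - {e}\<rparr>) v)" .
    moreover have "even (deg R v)"
      using even[OF _ v, of "edges R"] coreR by (simp add: sub_coregraphs_def)
    ultimately show False using D[of v] e(3) by simp
  qed
  then obtain v where "verts R = {v}" by blast
  then show ?thesis
    using subdivision_transport[OF bouquet_iso[OF R(2)] finite_bouquet R(1)] by blast
qed

lemma bouquet_imp_lower_eq:
  assumes "is_subdivision_of H (bouquet n)"
  shows "real (card (sub_coregraphs H)) = 2 powi nullity H"
proof -
  obtain R where R: "subdivide\<^sup>*\<^sup>* (bouquet n) R" "mgraph_iso R H"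
    using assms by (auto simp: is_subdivision_of_def)
  note inv = subdivisions_invariants[OF R(1) finite_bouquet]
  have "nullity (bouquet n) = int n" by (simp add: nullity_def bouquet_def)
  then show ?thesis
    using mgraph_iso_invariants(1,2)[OF inv(1) R(2)] inv(2,3)
    by (simp add: card_sub_coregraphs_bouquet)
qed

lemma handshake:
  assumes fin: "finite_mgraph G"
  shows "(\<Sum>v\<in>verts G. deg G v) = 2 * card (edges G)"
proof -
  have "(\<Sum>v\<in>verts G. deg G v) = (\<Sum>e\<in>edges G. \<Sum>v\<in>verts G. count (ends G e) v)"
    unfolding deg_def by (rule sum.swap)
  also have "\<dots> = (\<Sum>e\<in>edges G. 2)"
  proof (rule sum.cong[OF refl])
    fix e assume e: "e \<in> edges G"
    then have "2 = (\<Sum>v\<in>set_mset (ends G e). count (ends G e) v)"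
      using fin by (simp add: finite_mgraph_def flip: size_multiset_overloaded_eq)
    also have "\<dots> = (\<Sum>v\<in>verts G. count (ends G e) v)"
      using fin e by (intro sum.mono_neutral_left) (auto simp: finite_mgraph_def not_in_iff)
    finally show "(\<Sum>v\<in>verts G. count (ends G e) v) = 2" by simp
  qed
  finally show ?thesis by simp
qed

text \<open>
  The vertex \<open>x\<close> of degree 3 survives the suppression of the vertices of degree 2. So either it is the
  only vertex left, or there is no vertex of degree 2 left and none is isolated.
\<close>

lemma max_deg_3_imp_regular:
  assumes fin: "finite_mgraph H" and con: "connected_mgraph H" and core: "is_coregraph H"
    and le: "\<forall>v\<in>verts H. deg H v \<le> 3" and x: "x \<in> verts H" "deg H x = 3"
  shows "is_subdivision_of_regular H 3"
proof -
  obtain R where R: "subdivide\<^sup>*\<^sup>* R H" "finite_mgraph R" "connected_mgraph R"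
    and red: "(\<exists>v. verts R = {v}) \<or> (\<forall>v\<in>verts R. deg R v \<noteq> 2)"
    using exists_unsubdivided[OF fin con] by blast
  note inv = subdivisions_invariants[OF R(1,2)]
  have xR: "x \<in> verts R" using inv(6)[of x] x by force
  have "deg R v = 3" if v: "v \<in> verts R" for v
  proof (cases "v = x")
    case True
    then show ?thesis using inv(5)[OF v] x by simp
  next
    case False
    then have "deg R v \<noteq> 2" using red v xR by auto
    moreover obtain e y where "e \<in> edges R" "ends R e = {#v, y#}"
      using connected_leaving_edge[OF R(3) v xR False] .
    then have "deg R v \<noteq> 0" using deg_eq_0_iff[OF R(2), of v] by auto
    moreover have "v \<in> verts H" using inv(4) v by blast
    then have "deg R v \<noteq> 1" "deg R v \<le> 3"
      using inv(5)[OF v] core le by (auto simp: is_coregraph_def)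
    ultimately show ?thesis by linarith
  qed
  moreover obtain B :: "(nat, nat) mgraph" where B: "finite_mgraph B" "mgraph_iso B R"
    using nat_copy[OF R(2)] .
  ultimately have "\<forall>v\<in>verts B. deg B v = 3"
    using mgraph_iso_invariants(3)[OF B] by (metis imageE imageI)
  then show ?thesis
    using B(1) subdivision_transport[OF B(2,1) R(1)] by (auto simp: is_subdivision_of_regular_def)
qed

text \<open>
  An isolated vertex is the whole graph by connectivity; otherwise all degrees are 2, and the sum of
  the degrees shows that there are as many edges as vertices.
\<close>

lemma max_deg_2_imp_nullity:
  assumes fin: "finite_mgraph H" and con: "connected_mgraph H" and core: "is_coregraph H"
    and le: "\<forall>v\<in>verts H. deg H v \<le> 2"
  shows "nullity H = 0 \<or> nullity H = 1"
proof (cases "\<exists>v\<in>verts H. deg H v = 0")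
  case True
  then obtain v where v: "v \<in> verts H" "deg H v = 0" by blast
  then have noedge: "\<And>e. e \<in> edges H \<Longrightarrow> v \<notin># ends H e"
    using deg_eq_0_iff[OF fin] by blast
  have "x = v" if x: "x \<in> verts H" for x
  proof (rule ccontr)
    assume "x \<noteq> v"
    then obtain e y where "e \<in> edges H" "ends H e = {#v, y#}"
      using connected_leaving_edge[OF con v(1) x] by metis
    then show False using noedge[of e] by simp
  qed
  then have V: "verts H = {v}" using v by blast
  moreover have "edges H = {}"
  proof (rule ccontr)
    assume "edges H \<noteq> {}"
    then obtain e where e: "e \<in> edges H" by blast
    show False
      by (rule ends_pair[OF fin e]) (use noedge[OF e] V in auto)
  qed
  ultimately show ?thesis by (simp add: nullity_def)
next
  case False
  have "deg H v = 2" if "v \<in> verts H" for v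
    using False that core le by (force simp: is_coregraph_def numeral_2_eq_2 le_Suc_eq)
  then show ?thesis using handshake[OF fin] by (simp add: nullity_def)
qed

lemma regular_imp_max_deg_3:
  assumes "is_subdivision_of_regular H 3" "v \<in> verts H"
  shows "deg H v \<le> 3"
proof -
  obtain R :: "(nat, nat) mgraph" and R' where fin: "finite_mgraph R" and reg: "\<forall>v\<in>verts R. deg R v = 3"
    and R': "subdivide\<^sup>*\<^sup>* R R'" "mgraph_iso R' H"
    using assms(1) by (auto simp: is_subdivision_of_regular_def is_subdivision_of_def)
  note inv = subdivisions_invariants[OF R'(1) fin]
  have "deg R' x \<le> 3" if "x \<in> verts R'" for x
    using that inv(5,6)[of x] reg by (cases "x \<in> verts R") auto
  moreover have "deg H v \<in> deg R' ` verts R'"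
    using mgraph_iso_invariants(3)[OF inv(1) R'(2)] assms(2) by blast
  ultimately show ?thesis by auto
qed

theorem theorem4:
  fixes G :: "('v, 'e) mgraph"
  assumes "finite_mgraph G" and "connected_mgraph G"
  shows "(2::real) powi nullity G \<le> real (card (sub_coregraphs G)) \<and>
    real (card (sub_coregraphs G))
      \<le> ((5 - sqrt 5) / 2) powi (nullity G - 1) + ((5 + sqrt 5) / 2) powi (nullity G - 1) \<and>
    (real (card (sub_coregraphs G)) = 2 powi nullity G
      \<longleftrightarrow> (\<exists>n. is_subdivision_of (core G) (bouquet n))) \<and>
    (real (card (sub_coregraphs G))
        = ((5 - sqrt 5) / 2) powi (nullity G - 1) + ((5 + sqrt 5) / 2) powi (nullity G - 1)
      \<longleftrightarrow> is_subdivision_of_regular (core G) 3 \<or> is_tree G \<or> nullity G = 1)"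
proof (intro conjI)
  note core = core_invariants[OF assms(1)] and coregraph = clip_core(2)[OF assms(1)]
  note con = core(4)[OF assms(2)]
  let ?upper = "((5 - sqrt 5) / 2) powi (nullity G - 1) + ((5 + sqrt 5) / 2) powi (nullity G - 1)"
  show lower: "2 powi nullity G \<le> real (card (sub_coregraphs G))"
    by (rule card_sub_coregraphs_lower[OF assms])
  show upper: "real (card (sub_coregraphs G)) \<le> ?upper"
    by (rule card_sub_coregraphs_upper[OF assms])
  show "real (card (sub_coregraphs G)) = 2 powi nullity G
      \<longleftrightarrow> (\<exists>n. is_subdivision_of (core G) (bouquet n))"
    using lower_eq_imp_bouquet[OF core(1) con coregraph] bouquet_imp_lower_eq[of "core G"]
    by (auto simp: core(2,3))
  show "real (card (sub_coregraphs G)) = ?upper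
      \<longleftrightarrow> is_subdivision_of_regular (core G) 3 \<or> is_tree G \<or> nullity G = 1"
  proof
    assume "real (card (sub_coregraphs G)) = ?upper"
    then have le: "\<forall>v\<in>verts (core G). deg (core G) v \<le> 3"
      using card_sub_coregraphs_upper_eq_iff[OF core(1) con coregraph] by (simp add: core(2,3))
    show "is_subdivision_of_regular (core G) 3 \<or> is_tree G \<or> nullity G = 1"
    proof (cases "\<exists>x\<in>verts (core G). deg (core G) x = 3")
      case True
      then show ?thesis using max_deg_3_imp_regular[OF core(1) con coregraph le] by blast
    next
      case False
      then have "\<forall>v\<in>verts (core G). deg (core G) v \<le> 2"
        using le by (force simp: numeral_3_eq_3 numeral_2_eq_2 le_Suc_eq)
      then show ?thesis
        using max_deg_2_imp_nullity[OF core(1) con coregraph] is_tree_iff_nullity[OF assms]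
        by (simp add: core(3))
    qed
  next
    assume "is_subdivision_of_regular (core G) 3 \<or> is_tree G \<or> nullity G = 1"
    then consider "is_subdivision_of_regular (core G) 3" | "nullity G = 0" | "nullity G = 1"
      using is_tree_iff_nullity[OF assms] by blast
    then show "real (card (sub_coregraphs G)) = ?upper"
    proof cases
      case 1
      then show ?thesis
        using card_sub_coregraphs_upper_eq_iff[OF core(1) con coregraph] regular_imp_max_deg_3
        by (auto simp: core(2,3))
    next
      case 2
      (* For nullity 0 both bounds are 1, and for nullity 1 both are 2. *)
      then show ?thesis using lower upper golden_powi_minus_1 by simp
    next
      case 3
      then show ?thesis using lower upper by simp
    qed
  qed
qed

end
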